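(* Let $\Omega$ be a bounded Lipschitz subdomain of $\mathbf{R}^n$ and $p\in(\frac{n}{n+1},1]$. Then there is a finite constant $C=C(p,n,\Omega)$ such that any $u\in C_0^\infty(\Omega)$ satisfies the inequality $$\int_\Omega\left(\frac{|u(x)|}{d(x,\partial\Omega)}\right)^p dx\leq C\sum_{j=1}^n\|D_ju\|^p_{H^p(\mathbf{R}^n)}.$$
   Context: Here $d(x,\partial\Omega)$ is the distance from $x$ to $\partial\Omega$, and $u\in C_0^\infty(\Omega)$ is extended by zero to $\mathbf{R}^n$. Hardy space: fix $\psi\in C_0^\infty(\mathbf{R}^n)$ with $\int\psi=1$ and $\operatorname{supp}\psi\subset\{x:|x|\leq 1\}$, and put $\psi_t(y)=t^{-n}\psi(y/t)$. For $p>0$, a tempered distribution $f$ belongs to $H^p(\mathbf{R}^n)$ iff $\mathcal{M}_\psi f(x):=\sup_{t>0}|f*\psi_t(x)|$ is in $L^p(\mathbf{R}^n)$, with $\|f\|_{H^p(\mathbf{R}^n)}:=\|\mathcal{M}_\psi f\|_{L^p}$. A bounded domain $\Omega\subset\mathbf{R}^n$ is Lipschitz if each point $x\in\partial\Omega$ has a neighbourhood $U$ such that, after an isometric change of coordinates, $U\cap\partial\Omega=\{(y,h(y)): y\in B(0,\delta)\cap\mathbf{R}^{n-1}\}$ and $\Omega$ lies, within $U$, below the graph of $h$; here $\delta>0$ and the Lipschitz function $h:B(0,\delta)\cap\mathbf{R}^{n-1}\to\mathbf{R}$ may depend on $x$, but the Lipschitz constants of the functions $h$ are uniformly bounded. 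*)

theory Defs
  imports "HOL-Analysis.Analysis"
begin

definition partial_deriv :: "'a::euclidean_space \<Rightarrow> ('a \<Rightarrow> complex) \<Rightarrow> 'a \<Rightarrow> complex" where
  "partial_deriv j f x = vector_derivative (\<lambda>t. f (x + t *\<^sub>R j)) (at 0)"

primrec iter_partial_deriv :: "'a::euclidean_space list \<Rightarrow> ('a \<Rightarrow> complex) \<Rightarrow> 'a \<Rightarrow> complex" where
  "iter_partial_deriv [] f = f"
| "iter_partial_deriv (j # js) f = partial_deriv j (iter_partial_deriv js f)"

text \<open>Differentiability of all iterated partial derivatives forces their continuity, so this is
  \<open>C\<^sup>\<infinity>\<close> on the whole space.\<close>

definition smooth :: "('a::euclidean_space \<Rightarrow> complex) \<Rightarrow> bool" where
  "smooth f \<longleftrightarrow> (\<forall>js \<in> lists Basis. \<forall>x. iter_partial_deriv js f differentiable (at x))"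

definition supp :: "('a::euclidean_space \<Rightarrow> complex) \<Rightarrow> 'a set" where
  "supp f = closure (support_on UNIV f)"

text \<open>An element of \<open>C\<^sub>0\<^sup>\<infinity>(\<Omega>)\<close> is represented by its extension by zero to the whole space.\<close>

definition test_functions :: "'a::euclidean_space set \<Rightarrow> ('a \<Rightarrow> complex) set" where
  "test_functions \<Omega> = {f. smooth f \<and> compact (supp f) \<and> supp f \<subseteq> \<Omega>}"

definition schwartz :: "('a::euclidean_space \<Rightarrow> complex) set" where
  "schwartz = {f. smooth f \<and>
     (\<forall>k. \<forall>js \<in> lists Basis. bounded (range (\<lambda>x. (1 + norm x) ^ k *\<^sub>R iter_partial_deriv js f x)))}"

definition schwartz_null_sequence :: "(nat \<Rightarrow> 'a::euclidean_space \<Rightarrow> complex) \<Rightarrow> bool" where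
  "schwartz_null_sequence \<phi> \<longleftrightarrow> (\<forall>m. \<phi> m \<in> schwartz) \<and>
     (\<forall>k. \<forall>js \<in> lists Basis.
        uniform_limit UNIV (\<lambda>m x. (1 + norm x) ^ k *\<^sub>R iter_partial_deriv js (\<phi> m) x) (\<lambda>_. 0) sequentially)"

text \<open>The Schwartz space is metrizable, so continuity of a linear functional is sequential
  continuity at zero. Values outside the Schwartz space are irrelevant.\<close>

definition tempered_distribution :: "(('a::euclidean_space \<Rightarrow> complex) \<Rightarrow> complex) \<Rightarrow> bool" where
  "tempered_distribution F \<longleftrightarrow>
     (\<forall>f \<in> schwartz. \<forall>g \<in> schwartz. F (\<lambda>x. f x + g x) = F f + F g) \<and>
     (\<forall>c. \<forall>f \<in> schwartz. F (\<lambda>x. c * f x) = c * F f) \<and>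
     (\<forall>\<phi>. schwartz_null_sequence \<phi> \<longrightarrow> (\<lambda>m. F (\<phi> m)) \<longlonglongrightarrow> 0)"

definition regular_distribution ::
    "('a::euclidean_space \<Rightarrow> complex) \<Rightarrow> ('a \<Rightarrow> complex) \<Rightarrow> complex" where
  "regular_distribution f \<phi> = (LINT y|lborel. f y * \<phi> y)"

definition distr_convolution ::
    "(('a::euclidean_space \<Rightarrow> complex) \<Rightarrow> complex) \<Rightarrow> ('a \<Rightarrow> complex) \<Rightarrow> 'a \<Rightarrow> complex" where
  "distr_convolution F \<phi> x = F (\<lambda>y. \<phi> (x - y))"

text \<open>Only exponents \<open>p > 0\<close> are intended; then \<open>\<infinity>\<close> has the power \<open>\<infinity>\<close>.\<close>

definition ennreal_powr :: "ennreal \<Rightarrow> real \<Rightarrow> ennreal" where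
  "ennreal_powr x p = (if x = \<infinity> then \<infinity> else ennreal (enn2real x powr p))"

definition dilate :: "('a::euclidean_space \<Rightarrow> complex) \<Rightarrow> real \<Rightarrow> 'a \<Rightarrow> complex" where
  "dilate \<psi> t y = (1 / t ^ DIM('a)) *\<^sub>R \<psi> ((1 / t) *\<^sub>R y)"

definition hardy_kernel :: "('a::euclidean_space \<Rightarrow> complex) \<Rightarrow> bool" where
  "hardy_kernel \<psi> \<longleftrightarrow>
     \<psi> \<in> test_functions UNIV \<and> (LINT y|lborel. \<psi> y) = 1 \<and> supp \<psi> \<subseteq> cball 0 1"

definition maximal_function ::
    "('a::euclidean_space \<Rightarrow> complex) \<Rightarrow> (('a \<Rightarrow> complex) \<Rightarrow> complex) \<Rightarrow> 'a \<Rightarrow> ennreal" where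
  "maximal_function \<psi> F x = (SUP t \<in> {0<..}. ennreal (norm (distr_convolution F (dilate \<psi> t) x)))"

definition hardy_norm ::
    "('a::euclidean_space \<Rightarrow> complex) \<Rightarrow> real \<Rightarrow> (('a \<Rightarrow> complex) \<Rightarrow> complex) \<Rightarrow> ennreal" where
  "hardy_norm \<psi> p F =
     ennreal_powr (\<integral>\<^sup>+x. ennreal_powr (maximal_function \<psi> F x) p \<partial>lborel) (1 / p)"

definition hardy_space ::
    "('a::euclidean_space \<Rightarrow> complex) \<Rightarrow> real \<Rightarrow> (('a \<Rightarrow> complex) \<Rightarrow> complex) set" where
  "hardy_space \<psi> p = {F. tempered_distribution F \<and>
     maximal_function \<psi> F \<in> borel_measurable lborel \<and> hardy_norm \<psi> p F < \<infinity>}"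

text \<open>The factor \<open>\<real>\<^sup>n\<^sup>-\<^sup>1\<close> of the local coordinates \<open>(y, s)\<close> is the hyperplane orthogonal to a basis
  vector \<open>e\<close>, so \<open>(y, s)\<close> is the point \<open>y + s e\<close>. The constant \<open>L\<close> does not depend on the boundary
  point.\<close>

definition base_disc :: "'a::euclidean_space \<Rightarrow> real \<Rightarrow> 'a set" where
  "base_disc e \<delta> = {y \<in> ball 0 \<delta>. y \<bullet> e = 0}"

definition lipschitz_domain :: "'a::euclidean_space set \<Rightarrow> bool" where
  "lipschitz_domain \<Omega> \<longleftrightarrow> open \<Omega> \<and> connected \<Omega> \<and> \<Omega> \<noteq> {} \<and>
     (\<exists>L. \<forall>x \<in> frontier \<Omega>. \<exists>U (T :: 'a \<Rightarrow> 'a). \<exists>e \<in> Basis. \<exists>\<delta> > 0. \<exists>h :: 'a \<Rightarrow> real.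
        open U \<and> x \<in> U \<and> (\<forall>a b. dist (T a) (T b) = dist a b) \<and>
        L-lipschitz_on (base_disc e \<delta>) h \<and>
        T ` (U \<inter> frontier \<Omega>) = {y + h y *\<^sub>R e | y. y \<in> base_disc e \<delta>} \<and>
        T ` (U \<inter> \<Omega>) = T ` U \<inter> {y + s *\<^sub>R e | y s. y \<in> base_disc e \<delta> \<and> s < h y})"

lemma iter_partial_deriv_append:
  "iter_partial_deriv (is @ js) f = iter_partial_deriv is (iter_partial_deriv js f)"
  by (induction "is") auto

lemma smooth_partial_deriv:
  assumes "smooth f" "j \<in> Basis"
  shows "smooth (partial_deriv j f)"
  unfolding smooth_def
proof (intro ballI allI)
  fix js :: "'a list" and x assume "js \<in> lists Basis"
  then have "js @ [j] \<in> lists Basis" using assms(2) by simp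
  then have "iter_partial_deriv (js @ [j]) f differentiable (at x)"
    using assms(1) unfolding smooth_def by blast
  then show "iter_partial_deriv js (partial_deriv j f) differentiable (at x)"
    by (simp add: iter_partial_deriv_append)
qed

lemma supp_partial_deriv: "supp (partial_deriv j f) \<subseteq> supp f"
proof -
  have "partial_deriv j f x = 0" if "x \<notin> supp f" for x
  proof -
    have "open (- supp f)" by (simp add: supp_def open_Compl)
    moreover have "((\<lambda>t. x + t *\<^sub>R j) \<longlongrightarrow> x + 0 *\<^sub>R j) (nhds 0)"
      by (intro tendsto_intros filterlim_ident)
    ultimately have "\<forall>\<^sub>F t in nhds 0. x + t *\<^sub>R j \<in> - supp f"
      using that topological_tendstoD[of _ x _ "- supp f"] by simp
    moreover have "y \<in> - supp f \<Longrightarrow> f y = 0" for y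
      using closure_subset[of "support_on UNIV f"] by (auto simp: supp_def support_on_def)
    ultimately have ev: "\<forall>\<^sub>F t in nhds 0. f (x + t *\<^sub>R j) = 0"
      by (auto elim: eventually_mono)
    have "((\<lambda>t. f (x + t *\<^sub>R j)) has_vector_derivative 0) (at 0)"
      using has_vector_derivative_cong_ev[where x = 0 and S = UNIV and g = "\<lambda>_. 0"
          and f = "\<lambda>t. f (x + t *\<^sub>R j)" and f' = 0] ev
        eventually_nhds_x_imp_x[OF ev] by (auto elim: eventually_mono)
    then show ?thesis by (simp add: partial_deriv_def vector_derivative_at)
  qed
  then have "support_on UNIV (partial_deriv j f) \<subseteq> supp f" by (auto simp: support_on_def)
  then show ?thesis by (simp add: supp_def closure_minimal)
qed

lemma test_functions_partial_deriv:
  assumes "f \<in> test_functions \<Omega>" "j \<in> Basis"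
  shows "partial_deriv j f \<in> test_functions \<Omega>"
proof -
  have "compact (supp f)" using assms(1) by (simp add: test_functions_def)
  then have "compact (supp (partial_deriv j f))"
    using supp_partial_deriv[of j f] unfolding compact_eq_bounded_closed
    by (auto simp: supp_def intro: bounded_subset)
  then show ?thesis
    using assms smooth_partial_deriv[OF _ assms(2)] supp_partial_deriv[of j f]
    by (auto simp: test_functions_def)
qed

lemma smooth_continuous_on:
  assumes "smooth f"
  shows "continuous_on S f"
proof -
  have "f differentiable (at x)" for x
    using assms unfolding smooth_def by (metis iter_partial_deriv.simps(1) lists.Nil)
  then show ?thesis
    by (meson continuous_at_imp_continuous_on differentiable_imp_continuous_within)
qed

lemma tempered_distribution_test_function:
  assumes f: "f \<in> test_functions \<Omega>"
  shows "tempered_distribution (regular_distribution f)"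
proof -
  have int: "integrable lborel (\<lambda>y. f y * g y)" if "continuous_on UNIV g" for g
  proof -
    have "continuous_on (supp f) (\<lambda>y. f y * g y)"
      using f that smooth_continuous_on[of f]
      by (intro continuous_intros) (auto simp: test_functions_def intro: continuous_on_subset)
    then have "set_integrable lborel (supp f) (\<lambda>y. f y * g y)"
      using f by (intro borel_integrable_compact[folded set_integrable_def])
        (auto simp: test_functions_def)
    moreover have "indicator (supp f) y *\<^sub>R (f y * g y) = f y * g y" for y
      using closure_subset[of "support_on UNIV f"]
      by (auto simp: indicator_def supp_def support_on_def)
    ultimately show ?thesis by (simp add: set_integrable_def)
  qed
  have cont: "continuous_on UNIV g" if "g \<in> schwartz" for g :: "'a \<Rightarrow> complex"
    using that smooth_continuous_on by (auto simp: schwartz_def)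
  have int_f: "integrable lborel f" using int[of "\<lambda>_. 1"] by simp
  have "(\<lambda>m. regular_distribution f (\<phi> m)) \<longlonglongrightarrow> 0" if \<phi>: "schwartz_null_sequence \<phi>" for \<phi>
  proof (rule LIMSEQ_I)
    fix r :: real assume r: "0 < r"
    define I where "I = (LINT y|lborel. norm (f y))"
    have I: "0 \<le> I" by (simp add: I_def)
    have "uniform_limit UNIV (\<lambda>m x. (1 + norm x) ^ 0 *\<^sub>R iter_partial_deriv [] (\<phi> m) x) (\<lambda>_. 0) sequentially"
      using \<phi> unfolding schwartz_null_sequence_def by blast
    then have "uniform_limit UNIV \<phi> (\<lambda>_. 0) sequentially" by simp
    moreover have "0 < r / (I + 1)" using r I by simp
    ultimately obtain M where M: "\<And>m x. m \<ge> M \<Longrightarrow> norm (\<phi> m x) < r / (I + 1)"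
      unfolding uniform_limit_sequentially_iff by (metis UNIV_I dist_0_norm dist_commute)
    have "norm (regular_distribution f (\<phi> m) - 0) < r" if m: "m \<ge> M" for m
    proof -
      have i: "integrable lborel (\<lambda>y. f y * \<phi> m y)"
        using int cont \<phi> by (simp add: schwartz_null_sequence_def)
      have "norm (regular_distribution f (\<phi> m)) \<le> (LINT y|lborel. norm (f y * \<phi> m y))"
        unfolding regular_distribution_def by (rule integral_norm_bound)
      also have "\<dots> \<le> (LINT y|lborel. norm (f y) * (r / (I + 1)))"
      proof (rule integral_mono)
        show "integrable lborel (\<lambda>y. norm (f y * \<phi> m y))" using i by (rule integrable_norm)
        show "integrable lborel (\<lambda>y. norm (f y) * (r / (I + 1)))"
          using int_f by (intro integrable_mult_left integrable_norm)
        show "norm (f y * \<phi> m y) \<le> norm (f y) * (r / (I + 1))" for y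
          unfolding norm_mult using M[OF m, of y] by (intro mult_left_mono) auto
      qed
      also have "\<dots> = I * (r / (I + 1))"
        unfolding I_def by simp
      also have "\<dots> < r" using r I by (simp add: field_simps)
      finally show ?thesis by simp
    qed
    then show "\<exists>no. \<forall>n\<ge>no. norm (regular_distribution f (\<phi> n) - 0) < r" by blast
  qed
  moreover have "regular_distribution f (\<lambda>x. c * g x) = c * regular_distribution f g" for c g
    unfolding regular_distribution_def
    by (subst integral_mult_right_zero[symmetric]) (simp add: mult_ac)
  ultimately show ?thesis
    by (auto simp: tempered_distribution_def regular_distribution_def distrib_left int cont)
qed

end

(* For a kernel psi write A_s g = g * psi_s; these averages commute. Put P_k = A_(t/2^k). The operators
   T_k = 2 P_k - P_k P_k tend to the identity, and T_(k+1) - T_k is a sum of four terms +-(1 - P_i) P_j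
   with i, j in {k, k+1}. Hence g is controlled by P_0 g and by the oscillation of each P_j g at its own
   scale.

   For f = D_j u apply this to g = A_t f. The oscillation of A_t A_(t/2^k) f at scale t/2^k is at most 2^-k times the
   mean of |A_(t/2^k) f| over a ball of radius 3t. Splitting |A_s f| = |A_s f|^r |A_s f|^(1-r) bounds the
   Peetre maximal function F(x) = sup |A_s f(y)| (1 + |x-y|/s)^(-n/r) by
   F <= C F^(1-r) HL(M^r), where M is the vertical maximal function and HL the Hardy-Littlewood one; the
   series converges because n/(n+1) < r. Choosing r < p, the maximal theorem in L^(p/r) gives
   ||F||_p <= C ||M||_p.

   For g = u and t = d(x), the gradient of A_s u is an average of grad u, so the oscillations are at most
   C t 2^-k sum_j F_j(x). A Lipschitz domain has exterior balls of radius d(x) at distance at most K d(x) from x;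
   A_t u vanishes at the centre of such a ball, so |A_t u(x)| <= C t sum_j F_j(x) as well. *)

theory Submission
  imports Defs
begin

subsection \<open>The Hardy--Littlewood maximal theorem\<close>

text \<open>The kernel is only known to have integral one, so no reproducing formula with vanishing
  moments is at hand; the telescoping sum takes its place. The exponents then decide. At scale t/2^k
  the Peetre weight with N = n/r costs 2^(k N (1-r)), while the Lipschitz kernel gains 2^-k. The
  ratio is below 1 iff n (1-r)/r < 1, that is r > n/(n+1), and the maximal theorem wants p/r > 1;
  such an r exists exactly when p > n/(n+1). The factor F^(1-r) can be divided out only if F is
  finite. For this reason all estimates run in the class of bounded Lipschitz functions, which
  contains the test functions and their derivatives and is preserved by averaging. What matters
  there is that F also sees points y away from x, at a polynomial cost: this allows the comparison
  with a point at distance K d(x).\<close>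

lemma nn_integral_powr_Ioo:
  fixes a b :: real
  assumes "a > -1" "b \<ge> 0"
  shows "(\<integral>\<^sup>+\<mu>. ennreal (\<mu> powr a) * indicator {0<..<b} \<mu> \<partial>lborel) = ennreal (b powr (a + 1) / (a + 1))"
proof -
  have "((\<lambda>x. x powr a) has_integral (b powr (a+1) / (a+1))) {0<..<b}"
    using has_integral_powr_from_0[OF assms] by (simp add: has_integral_Icc_iff_Ioo)
  then have "((\<lambda>x. if x \<in> {0<..<b} then x powr a else 0) has_integral (b powr (a+1) / (a+1))) UNIV"
    by (simp only: has_integral_restrict_UNIV)
  then have "integral\<^sup>N lborel (\<lambda>x. ennreal (if x \<in> {0<..<b} then x powr a else 0)) = ennreal (b powr (a+1) / (a+1))"
    by (intro nn_integral_has_integral_lborel) auto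
  moreover have "ennreal (x powr a) * indicator {0<..<b} x = ennreal (if x \<in> {0<..<b} then x powr a else 0)" for x
    by (auto simp: indicator_def)
  ultimately show ?thesis by simp
qed

text \<open>A form of Marcinkiewicz interpolation. Writing \<open>h x powr q\<close> as the integral
  of q \<mu>^(q-1) over 0 < \<mu> < h x and exchanging the integrals turns the weak bound into the
  integral of \<mu>^(q-2) over 0 < \<mu> < g x / c. It converges at 0 because q > 1, and it yields
  the constant.\<close>

lemma layer_cake_powr_le:
  fixes h g :: "'a::euclidean_space \<Rightarrow> real"
  assumes [measurable]: "h \<in> borel_measurable borel" "g \<in> borel_measurable borel"
    and h0: "\<And>x. 0 \<le> h x" and g0: "\<And>x. 0 \<le> g x"
    and c: "0 < c" and A: "0 \<le> A" and q: "1 < q"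
    and weak: "\<And>\<mu>. 0 < \<mu> \<Longrightarrow> emeasure lborel {x. \<mu> < h x} \<le>
      ennreal (A / \<mu>) * (\<integral>\<^sup>+x. ennreal (g x) * indicator {x. c * \<mu> < g x} x \<partial>lborel)"
  shows "(\<integral>\<^sup>+x. ennreal (h x powr q) \<partial>lborel) \<le>
    ennreal (A * q * c powr (1 - q) / (q - 1)) * (\<integral>\<^sup>+x. ennreal (g x powr q) \<partial>lborel)"
proof -
  have hq: "ennreal (h x powr q) = (\<integral>\<^sup>+\<mu>. ennreal (q * \<mu> powr (q - 1)) * indicator {0<..<h x} \<mu> \<partial>lborel)" for x
  proof -
    have "(\<integral>\<^sup>+\<mu>. ennreal (q * \<mu> powr (q - 1)) * indicator {0<..<h x} \<mu> \<partial>lborel) =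
        (\<integral>\<^sup>+\<mu>. ennreal q * (ennreal (\<mu> powr (q - 1)) * indicator {0<..<h x} \<mu>) \<partial>lborel)"
      using q by (intro nn_integral_cong) (simp add: ennreal_mult mult.assoc)
    also have "\<dots> = ennreal q * (\<integral>\<^sup>+\<mu>. ennreal (\<mu> powr (q - 1)) * indicator {0<..<h x} \<mu> \<partial>lborel)"
      by (rule nn_integral_cmult) simp
    also have "\<dots> = ennreal q * ennreal (h x powr (q - 1 + 1) / (q - 1 + 1))"
      using q h0 by (subst nn_integral_powr_Ioo) auto
    also have "\<dots> = ennreal (h x powr q)"
      using q by (simp add: ennreal_mult[symmetric])
    finally show ?thesis by simp
  qed
  have meas1: "(\<lambda>(\<mu>, x). ennreal (q * \<mu> powr (q - 1)) * indicator {0<..<h x} \<mu>)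
      \<in> borel_measurable (lborel \<Otimes>\<^sub>M lborel)"
    unfolding indicator_def by (simp add: split_beta') measurable
  have meas2: "(\<lambda>(\<mu>, x). ennreal (A * q * \<mu> powr (q - 2) * g x) * indicator {0<..<g x / c} \<mu>)
      \<in> borel_measurable (lborel \<Otimes>\<^sub>M lborel)"
    unfolding indicator_def by (simp add: split_beta') measurable
  have inner: "(\<integral>\<^sup>+x. ennreal (q * \<mu> powr (q - 1)) * indicator {0<..<h x} \<mu> \<partial>lborel)
      \<le> (\<integral>\<^sup>+x. ennreal (A * q * \<mu> powr (q - 2) * g x) * indicator {0<..<g x / c} \<mu> \<partial>lborel)" for \<mu>
  proof (cases "0 < \<mu>")
    case True
    have "(\<integral>\<^sup>+x. ennreal (q * \<mu> powr (q - 1)) * indicator {0<..<h x} \<mu> \<partial>lborel) =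
        (\<integral>\<^sup>+x. ennreal (q * \<mu> powr (q - 1)) * indicator {x. \<mu> < h x} x \<partial>lborel)"
      using True by (intro nn_integral_cong) (auto simp: indicator_def)
    also have "\<dots> = ennreal (q * \<mu> powr (q - 1)) * emeasure lborel {x. \<mu> < h x}"
      by (rule nn_integral_cmult_indicator) measurable
    also have "\<dots> \<le> ennreal (q * \<mu> powr (q - 1)) *
        (ennreal (A / \<mu>) * (\<integral>\<^sup>+x. ennreal (g x) * indicator {x. c * \<mu> < g x} x \<partial>lborel))"
      by (intro mult_left_mono weak True) auto
    also have "\<dots> = ennreal (A * q * \<mu> powr (q - 2)) *
        (\<integral>\<^sup>+x. ennreal (g x) * indicator {x. c * \<mu> < g x} x \<partial>lborel)"
    proof -
      have "\<mu> powr (q - 1) / \<mu> = \<mu> powr (q - 2)"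
        using True by (simp add: powr_diff power2_eq_square)
      then have "q * \<mu> powr (q - 1) * (A / \<mu>) = A * q * \<mu> powr (q - 2)"
        by (subst (asm) eq_commute) simp
      then show ?thesis
        using q A True by (simp add: mult.assoc[symmetric] ennreal_mult[symmetric])
    qed
    also have "\<dots> = (\<integral>\<^sup>+x. ennreal (A * q * \<mu> powr (q - 2)) *
        (ennreal (g x) * indicator {x. c * \<mu> < g x} x) \<partial>lborel)"
      by (rule nn_integral_cmult[symmetric]) measurable
    also have "\<dots> = (\<integral>\<^sup>+x. ennreal (A * q * \<mu> powr (q - 2) * g x) * indicator {0<..<g x / c} \<mu> \<partial>lborel)"
    proof (rule nn_integral_cong)
      fix x
      \<comment> \<open>The same condition, read as a restriction on \<mu> for fixed x, so that the
        integral in \<mu> can be done first.\<close>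
      have "indicator {x. c * \<mu> < g x} x = (indicator {0<..<g x / c} \<mu> :: ennreal)"
        using True c by (auto simp: indicator_def field_simps)
      then show "ennreal (A * q * \<mu> powr (q - 2)) * (ennreal (g x) * indicator {x. c * \<mu> < g x} x) =
          ennreal (A * q * \<mu> powr (q - 2) * g x) * indicator {0<..<g x / c} \<mu>"
        using q A g0[of x] by (simp add: ennreal_mult mult.assoc)
    qed
    finally show ?thesis .
  qed (simp add: indicator_def)
  have outer: "(\<integral>\<^sup>+\<mu>. ennreal (A * q * \<mu> powr (q - 2) * g x) * indicator {0<..<g x / c} \<mu> \<partial>lborel)
      = ennreal (A * q * c powr (1 - q) / (q - 1)) * ennreal (g x powr q)" for x
  proof -
    have "(\<integral>\<^sup>+\<mu>. ennreal (A * q * \<mu> powr (q - 2) * g x) * indicator {0<..<g x / c} \<mu> \<partial>lborel) =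
        (\<integral>\<^sup>+\<mu>. ennreal (A * q * g x) * (ennreal (\<mu> powr (q - 2)) * indicator {0<..<g x / c} \<mu>) \<partial>lborel)"
      using q A g0 by (intro nn_integral_cong) (simp add: ennreal_mult mult_ac)
    also have "\<dots> = ennreal (A * q * g x) * (\<integral>\<^sup>+\<mu>. ennreal (\<mu> powr (q - 2)) * indicator {0<..<g x / c} \<mu> \<partial>lborel)"
      by (rule nn_integral_cmult) simp
    also have "\<dots> = ennreal (A * q * g x) * ennreal ((g x / c) powr (q - 2 + 1) / (q - 2 + 1))"
      using q g0 c by (subst nn_integral_powr_Ioo) auto
    also have "\<dots> = ennreal (A * q * g x * ((g x / c) powr (q - 2 + 1) / (q - 2 + 1)))"
      using q g0[of x] A by (intro ennreal_mult[symmetric]) auto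
    also have "A * q * g x * ((g x / c) powr (q - 2 + 1) / (q - 2 + 1)) =
        A * q * c powr (1 - q) / (q - 1) * g x powr q"
    proof (cases "g x = 0")
      case False
      then have "0 < g x" using g0[of x] by simp
      moreover have "c powr (1 - q) = inverse (c powr (q - 1))"
        by (metis minus_diff_eq powr_minus)
      ultimately show ?thesis
        using c q by (simp add: powr_divide powr_diff field_simps)
    qed simp
    also have "ennreal (A * q * c powr (1 - q) / (q - 1) * g x powr q) =
        ennreal (A * q * c powr (1 - q) / (q - 1)) * ennreal (g x powr q)"
      using q A by (intro ennreal_mult) auto
    finally show ?thesis .
  qed
  have "(\<integral>\<^sup>+x. ennreal (h x powr q) \<partial>lborel) =
      (\<integral>\<^sup>+x. \<integral>\<^sup>+\<mu>. ennreal (q * \<mu> powr (q - 1)) * indicator {0<..<h x} \<mu> \<partial>lborel \<partial>lborel)"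
    by (simp only: hq)
  also have "\<dots> = (\<integral>\<^sup>+\<mu>. \<integral>\<^sup>+x. ennreal (q * \<mu> powr (q - 1)) * indicator {0<..<h x} \<mu> \<partial>lborel \<partial>lborel)"
    by (rule lborel_pair.Fubini'[OF meas1])
  also have "\<dots> \<le> (\<integral>\<^sup>+\<mu>. \<integral>\<^sup>+x. ennreal (A * q * \<mu> powr (q - 2) * g x) * indicator {0<..<g x / c} \<mu> \<partial>lborel \<partial>lborel)"
    by (intro nn_integral_mono inner)
  also have "\<dots> = (\<integral>\<^sup>+x. \<integral>\<^sup>+\<mu>. ennreal (A * q * \<mu> powr (q - 2) * g x) * indicator {0<..<g x / c} \<mu> \<partial>lborel \<partial>lborel)"
    by (rule lborel_pair.Fubini'[OF meas2, symmetric])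
  also have "\<dots> = ennreal (A * q * c powr (1 - q) / (q - 1)) * (\<integral>\<^sup>+x. ennreal (g x powr q) \<partial>lborel)"
    unfolding outer by (rule nn_integral_cmult) measurable
  finally show ?thesis .
qed

text \<open>Vitali covering: disjoint balls are selected whose fivefold enlargements cover S. Each
  enlarged ball has volume at most the constant times the integral of g over the original ball, and
  by disjointness these integrals add up to at most the total one.\<close>

lemma maximal_weak_type:
  fixes g :: "'a::euclidean_space \<Rightarrow> ennreal"
  assumes [measurable]: "g \<in> borel_measurable borel" and \<mu>: "0 < \<mu>"
    and S: "\<And>x. x \<in> S \<Longrightarrow> \<exists>\<rho>>0. ennreal (\<mu> * \<rho> ^ DIM('a)) < (\<integral>\<^sup>+y\<in>ball x \<rho>. g y \<partial>lborel)"
  shows "emeasure lborel S \<le> ennreal (5 ^ DIM('a) * unit_ball_vol DIM('a) / \<mu>) * (\<integral>\<^sup>+y. g y \<partial>lborel)"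
proof (cases "(\<integral>\<^sup>+y. g y \<partial>lborel) = \<infinity>")
  case True
  have "ennreal (5 ^ DIM('a) * unit_ball_vol DIM('a) / \<mu>) \<noteq> 0"
    using \<mu> by (simp del: times_divide_eq_left add: ennreal_eq_0_iff not_le)
  then show ?thesis using True by (simp add: ennreal_mult_top)
next
  case False
  define I where "I = enn2real (\<integral>\<^sup>+y. g y \<partial>lborel)"
  have I: "(\<integral>\<^sup>+y. g y \<partial>lborel) = ennreal I" "0 \<le> I" using False by (auto simp: I_def less_top)
  obtain \<rho> where \<rho>: "\<And>x. x \<in> S \<Longrightarrow> 0 < \<rho> x"
    "\<And>x. x \<in> S \<Longrightarrow> ennreal (\<mu> * \<rho> x ^ DIM('a)) < (\<integral>\<^sup>+y\<in>ball x (\<rho> x). g y \<partial>lborel)"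
    using S by metis
  \<comment> \<open>Vitali's lemma needs bounded radii. A radius above 1 is at most its own n-th
    power, which is below \<open>I / \<mu>\<close>.\<close>
  have bd: "\<rho> x \<le> max 1 (I / \<mu>)" if x: "x \<in> S" for x
  proof (cases "\<rho> x \<le> 1")
    case False
    have "ennreal (\<mu> * \<rho> x ^ DIM('a)) < (\<integral>\<^sup>+y\<in>ball x (\<rho> x). g y \<partial>lborel)" by (rule \<rho>(2)[OF x])
    also have "\<dots> \<le> ennreal I" unfolding I(1)[symmetric]
      by (intro nn_integral_mono) (auto simp: indicator_def)
    finally have "\<mu> * \<rho> x ^ DIM('a) < I" using I(2) \<mu> \<rho>(1)[OF x] by (simp add: ennreal_less_iff)
    then have "\<rho> x ^ DIM('a) < I / \<mu>" using \<mu> by (simp add: field_simps)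
    moreover have "\<rho> x \<le> \<rho> x ^ DIM('a)" using False by (intro self_le_power) auto
    ultimately show ?thesis by simp
  qed simp
  obtain C where C: "countable C" "C \<subseteq> S"
    "pairwise (\<lambda>i j. disjnt (cball i (\<rho> i)) (cball j (\<rho> j))) C"
    "S \<subseteq> (\<Union>i\<in>C. cball i (5 * \<rho> i))"
    proof (rule Vitali_covering_lemma_cballs)
    show "S \<subseteq> (\<Union>i\<in>S. cball i (\<rho> i))" using \<rho>(1) by force
    show "0 < \<rho> i \<and> \<rho> i \<le> max 1 (I / \<mu>)" if "i \<in> S" for i using \<rho>(1) bd that by blast
  qed
  have disj: "disjoint_family_on (\<lambda>i. ball i (\<rho> i)) C"
    unfolding disjoint_family_on_def
  proof (intro ballI impI)
    fix i j assume "i \<in> C" "j \<in> C" "i \<noteq> j"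
    then have "cball i (\<rho> i) \<inter> cball j (\<rho> j) = {}"
      using C(3) by (simp add: pairwise_def disjnt_def)
    then show "ball i (\<rho> i) \<inter> ball j (\<rho> j) = {}"
      using ball_subset_cball by blast
  qed
  have "emeasure lborel S \<le> emeasure lborel (\<Union>i\<in>C. cball i (5 * \<rho> i))"
    by (intro emeasure_mono C(4)) (use C(1) in \<open>auto intro!: sets.countable_UN'\<close>)
  also have "\<dots> \<le> (\<integral>\<^sup>+i. emeasure lborel (cball i (5 * \<rho> i)) \<partial>count_space C)"
  proof -
    have "emeasure lborel (\<Union>i\<in>C. cball i (5 * \<rho> i)) =
        (\<integral>\<^sup>+x. indicator (\<Union>i\<in>C. cball i (5 * \<rho> i)) x \<partial>lborel)"
      using C(1) by (intro nn_integral_indicator[symmetric]) (auto intro!: sets.countable_UN')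
    also have "\<dots> \<le> (\<integral>\<^sup>+x. \<integral>\<^sup>+i. indicator (cball i (5 * \<rho> i)) x \<partial>count_space C \<partial>lborel)"
    proof (intro nn_integral_mono)
      fix x
      show "indicator (\<Union>i\<in>C. cball i (5 * \<rho> i)) x \<le>
          (\<integral>\<^sup>+i. indicator (cball i (5 * \<rho> i)) x \<partial>count_space C)"
      proof (cases "x \<in> (\<Union>i\<in>C. cball i (5 * \<rho> i))")
        case True
        then obtain i where "i \<in> C" "x \<in> cball i (5 * \<rho> i)" by blast
        then show ?thesis
          using nn_integral_ge_point[of i C "\<lambda>i. indicator (cball i (5 * \<rho> i)) x"]
          by (auto simp: indicator_def split: if_splits)
      qed simp
    qed
    also have "\<dots> = (\<integral>\<^sup>+i. \<integral>\<^sup>+x. indicator (cball i (5 * \<rho> i)) x \<partial>lborel \<partial>count_space C)"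
      using C(1) by (intro nn_integral_count_space_nn_integral borel_measurable_indicator) auto
    finally show ?thesis by simp
  qed
  also have "\<dots> \<le> (\<integral>\<^sup>+i. ennreal (5 ^ DIM('a) * unit_ball_vol DIM('a) / \<mu>) *
      (\<integral>\<^sup>+y\<in>ball i (\<rho> i). g y \<partial>lborel) \<partial>count_space C)"
  proof (intro nn_integral_mono)
    fix i assume "i \<in> space (count_space C)"
    then have i: "i \<in> S" using C(2) by auto
    have "emeasure lborel (cball i (5 * \<rho> i)) = ennreal (unit_ball_vol DIM('a) * (5 * \<rho> i) ^ DIM('a))"
      using \<rho>(1)[OF i] by (intro emeasure_cball) auto
    also have "\<dots> = ennreal (5 ^ DIM('a) * unit_ball_vol DIM('a) / \<mu>) * ennreal (\<mu> * \<rho> i ^ DIM('a))"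
      using \<mu> \<rho>(1)[OF i] by (simp add: ennreal_mult[symmetric] power_mult_distrib mult_ac)
    also have "\<dots> \<le> ennreal (5 ^ DIM('a) * unit_ball_vol DIM('a) / \<mu>) * (\<integral>\<^sup>+y\<in>ball i (\<rho> i). g y \<partial>lborel)"
      using \<rho>(2)[OF i] by (intro mult_left_mono) auto
    finally show "emeasure lborel (cball i (5 * \<rho> i)) \<le> \<dots>" .
  qed
  also have "\<dots> = ennreal (5 ^ DIM('a) * unit_ball_vol DIM('a) / \<mu>) *
      (\<integral>\<^sup>+i. (\<integral>\<^sup>+y\<in>ball i (\<rho> i). g y \<partial>lborel) \<partial>count_space C)"
    by (rule nn_integral_cmult) auto
  \<comment> \<open>With g as a density, the integrals over the disjoint balls become values of a
    measure, and countable additivity applies.\<close>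
  also have "(\<integral>\<^sup>+i. (\<integral>\<^sup>+y\<in>ball i (\<rho> i). g y \<partial>lborel) \<partial>count_space C) =
      (\<integral>\<^sup>+i. emeasure (density lborel g) (ball i (\<rho> i)) \<partial>count_space C)"
    by (intro nn_integral_cong) (simp add: emeasure_density)
  also have "\<dots> = emeasure (density lborel g) (\<Union>i\<in>C. ball i (\<rho> i))"
    by (rule emeasure_UN_countable[symmetric]) (use C(1) disj in auto)
  also have "\<dots> \<le> emeasure (density lborel g) UNIV"
    by (intro emeasure_mono) auto
  also have "\<dots> = (\<integral>\<^sup>+y. g y \<partial>lborel)"
    by (simp add: emeasure_density)
  finally show ?thesis by (simp add: mult_left_mono)
qed

text \<open>The Hardy-Littlewood maximal function, normalised by the n-th power of the radius
  instead of the volume of the ball. Rational radii make it a countable supremum, which gives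
  measurability at once.\<close>

definition maximal_average :: "('a::euclidean_space \<Rightarrow> real) \<Rightarrow> 'a \<Rightarrow> ennreal" where
  "maximal_average g x =
    (SUP q\<in>{0<..}. ennreal (1 / of_rat q ^ DIM('a)) * (\<integral>\<^sup>+y\<in>ball x (of_rat q). ennreal (g y) \<partial>lborel))"

text \<open>Some rational radius lies between \<rho> and 2 \<rho>; this is the price of admitting
  rational radii only.\<close>

lemma nn_integral_ball_le_maximal_average:
  fixes g :: "'a::euclidean_space \<Rightarrow> real"
  assumes \<rho>: "0 < \<rho>"
  shows "(\<integral>\<^sup>+y\<in>ball x \<rho>. ennreal (g y) \<partial>lborel) \<le> ennreal ((2 * \<rho>) ^ DIM('a)) * maximal_average g x"
proof -
  obtain q :: rat where q: "\<rho> < of_rat q" "of_rat q < 2 * \<rho>"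
    using of_rat_dense[of \<rho> "2 * \<rho>"] \<rho> by auto
  then have q0: "0 < (of_rat q :: real)" using \<rho> by linarith
  then have "0 < q" by simp
  define I where "I = (\<integral>\<^sup>+y\<in>ball x (of_rat q). ennreal (g y) \<partial>lborel)"
  have "(\<integral>\<^sup>+y\<in>ball x \<rho>. ennreal (g y) \<partial>lborel) \<le> I"
    unfolding I_def using q by (intro nn_integral_mono) (auto simp: indicator_def)
  also have "I = ennreal (of_rat q ^ DIM('a)) * (ennreal (1 / of_rat q ^ DIM('a)) * I)"
    using q0 by (simp add: mult.assoc[symmetric] ennreal_mult[symmetric])
  also have "\<dots> \<le> ennreal ((2 * \<rho>) ^ DIM('a)) * maximal_average g x"
    unfolding I_def maximal_average_def using q q0 \<open>0 < q\<close> \<rho>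
    by (intro mult_mono SUP_upper ennreal_leI power_mono) auto
  finally show ?thesis .
qed

text \<open>\<open>enn2real\<close> sends infinity to 0, so an upper bound by the real value of a
  maximal function is meaningful only once it is known to be finite.\<close>

lemma maximal_average_less_top:
  fixes g :: "'a::euclidean_space \<Rightarrow> real"
  assumes "\<And>x. g x \<le> b" "0 \<le> b"
  shows "maximal_average g x < \<infinity>"
proof -
  have "maximal_average g x \<le> ennreal (b * unit_ball_vol DIM('a))"
    unfolding maximal_average_def
  proof (rule SUP_least)
    fix q :: rat assume "q \<in> {0<..}"
    then have q: "0 < (of_rat q :: real)" by simp
    have "(\<integral>\<^sup>+y\<in>ball x (of_rat q). ennreal (g y) \<partial>lborel) \<le> (\<integral>\<^sup>+y\<in>ball x (of_rat q). ennreal b \<partial>lborel)"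
      using assms(1) by (intro nn_integral_mono mult_right_mono ennreal_leI) auto
    also have "\<dots> = ennreal b * emeasure lborel (ball x (of_rat q))"
      by (rule nn_integral_cmult_indicator) simp
    also have "\<dots> = ennreal (b * (unit_ball_vol DIM('a) * of_rat q ^ DIM('a)))"
      using q assms(2) by (subst ennreal_mult) (simp_all add: emeasure_ball)
    finally have "ennreal (1 / of_rat q ^ DIM('a)) * (\<integral>\<^sup>+y\<in>ball x (of_rat q). ennreal (g y) \<partial>lborel) \<le>
        ennreal (1 / of_rat q ^ DIM('a)) * ennreal (b * (unit_ball_vol DIM('a) * of_rat q ^ DIM('a)))"
      by (rule mult_left_mono) simp
    also have "\<dots> = ennreal (1 / of_rat q ^ DIM('a) * (b * (unit_ball_vol DIM('a) * of_rat q ^ DIM('a))))"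
      using q assms(2) by (intro ennreal_mult[symmetric]) auto
    also have "1 / of_rat q ^ DIM('a) * (b * (unit_ball_vol DIM('a) * of_rat q ^ DIM('a))) = b * unit_ball_vol DIM('a)"
      using q by simp
    finally show "ennreal (1 / of_rat q ^ DIM('a)) * (\<integral>\<^sup>+y\<in>ball x (of_rat q). ennreal (g y) \<partial>lborel) \<le>
        ennreal (b * unit_ball_vol DIM('a))" .
  qed
  also have "\<dots> < \<infinity>" by simp
  finally show ?thesis .
qed

lemma borel_measurable_maximal_average [measurable]:
  fixes g :: "'a::euclidean_space \<Rightarrow> real"
  assumes [measurable]: "g \<in> borel_measurable borel"
  shows "maximal_average g \<in> borel_measurable borel"
proof -
  have "(\<lambda>x. \<integral>\<^sup>+y. ennreal (g y) * indicator (ball x r) y \<partial>lborel) \<in> borel_measurable borel" for r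
  proof -
    have "(\<lambda>(x, y). ennreal (g y) * indicator (ball x r) y) \<in> borel_measurable (borel \<Otimes>\<^sub>M lborel)"
      unfolding indicator_def mem_ball by (simp add: split_beta') measurable
    from lborel.borel_measurable_nn_integral_fst[OF this] show ?thesis by simp
  qed
  then show ?thesis
    unfolding maximal_average_def[abs_def]
    by (intro borel_measurable_SUP borel_measurable_times) auto
qed

text \<open>Values of g up to \<mu>/(2 \<omega>), with \<omega> the volume of the unit ball,
  contribute at most (\<mu>/2) \<rho>^n to a ball of radius \<rho>. Where the average exceeds \<mu>,
  the large values of g therefore carry more than (\<mu>/2) \<rho>^n, and
  \<open>maximal_weak_type\<close> applies to them with \<mu>/2; hence the factor 2.\<close>

lemma maximal_average_weak_type:
  fixes g :: "'a::euclidean_space \<Rightarrow> real"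
  assumes [measurable]: "g \<in> borel_measurable borel" and g0: "\<And>x. 0 \<le> g x" and \<mu>: "0 < \<mu>"
  shows "emeasure lborel {x. ennreal \<mu> < maximal_average g x} \<le>
    ennreal (2 * 5 ^ DIM('a) * unit_ball_vol DIM('a) / \<mu>) *
      (\<integral>\<^sup>+x. ennreal (g x) * indicator {x. 1 / (2 * unit_ball_vol DIM('a)) * \<mu> < g x} x \<partial>lborel)"
proof -
  define \<omega> where "\<omega> = unit_ball_vol DIM('a)"
  have \<omega>: "0 < \<omega>" by (simp add: \<omega>_def unit_ball_vol_pos)
  define G where "G x = ennreal (g x) * indicator {x. 1 / (2 * \<omega>) * \<mu> < g x} x" for x
  have [measurable]: "G \<in> borel_measurable borel" unfolding G_def[abs_def] by measurable
  have "\<exists>\<rho>>0. ennreal (\<mu> / 2 * \<rho> ^ DIM('a)) < (\<integral>\<^sup>+y\<in>ball x \<rho>. G y \<partial>lborel)"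
    if "ennreal \<mu> < maximal_average g x" for x
  proof -
    from that obtain q :: rat where q: "0 < q"
      and lt: "ennreal \<mu> < ennreal (1 / of_rat q ^ DIM('a)) * (\<integral>\<^sup>+y\<in>ball x (of_rat q). ennreal (g y) \<partial>lborel)"
      unfolding maximal_average_def less_SUP_iff by auto
    define \<rho> where "\<rho> = (of_rat q :: real)"
    have \<rho>: "0 < \<rho>" using q by (simp add: \<rho>_def)
    have "ennreal (\<mu> * \<rho> ^ DIM('a)) = ennreal (\<rho> ^ DIM('a)) * ennreal \<mu>"
      using \<rho> \<mu> by (simp add: ennreal_mult[symmetric] mult.commute)
    also have "\<dots> < ennreal (\<rho> ^ DIM('a)) * (ennreal (1 / \<rho> ^ DIM('a)) * (\<integral>\<^sup>+y\<in>ball x \<rho>. ennreal (g y) \<partial>lborel))"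
      using lt \<rho> by (intro ennreal_mult_strict_left_mono) (auto simp: \<rho>_def)
    also have "\<dots> = (\<integral>\<^sup>+y\<in>ball x \<rho>. ennreal (g y) \<partial>lborel)"
      using \<rho> by (simp add: mult.assoc[symmetric] ennreal_mult[symmetric])
    also have "\<dots> \<le> (\<integral>\<^sup>+y. G y * indicator (ball x \<rho>) y + ennreal (1 / (2 * \<omega>) * \<mu>) * indicator (ball x \<rho>) y \<partial>lborel)"
      by (intro nn_integral_mono) (auto simp: G_def indicator_def intro!: ennreal_leI)
    also have "\<dots> = (\<integral>\<^sup>+y\<in>ball x \<rho>. G y \<partial>lborel) + (\<integral>\<^sup>+y\<in>ball x \<rho>. ennreal (1 / (2 * \<omega>) * \<mu>) \<partial>lborel)"
      proof (rule nn_integral_add)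
      have [measurable]: "indicator (ball x \<rho>) \<in> borel_measurable (lborel :: 'a measure)"
        by (intro borel_measurable_indicator) simp
      show "(\<lambda>y. G y * indicator (ball x \<rho>) y) \<in> borel_measurable lborel"
        by (rule borel_measurable_times_ennreal) auto
      show "(\<lambda>y. ennreal (1 / (2 * \<omega>) * \<mu>) * indicator (ball x \<rho>) y) \<in> borel_measurable lborel"
        by (rule borel_measurable_times_ennreal) auto
    qed
    also have "(\<integral>\<^sup>+y\<in>ball x \<rho>. ennreal (1 / (2 * \<omega>) * \<mu>) \<partial>lborel) = ennreal (\<mu> / 2 * \<rho> ^ DIM('a))"
    proof -
      have "(\<integral>\<^sup>+y\<in>ball x \<rho>. ennreal (1 / (2 * \<omega>) * \<mu>) \<partial>lborel) = ennreal (1 / (2 * \<omega>) * \<mu>) * emeasure lborel (ball x \<rho>)"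
        by (rule nn_integral_cmult_indicator) simp
      also have "\<dots> = ennreal (1 / (2 * \<omega>) * \<mu> * (\<omega> * \<rho> ^ DIM('a)))"
        using \<rho> \<omega> \<mu>
        by (subst ennreal_mult) (simp_all add: emeasure_ball \<omega>_def)
      also have "1 / (2 * \<omega>) * \<mu> * (\<omega> * \<rho> ^ DIM('a)) = \<mu> / 2 * \<rho> ^ DIM('a)"
        using \<omega> by (simp add: field_simps)
      finally show ?thesis .
    qed
    finally have *: "ennreal (\<mu> * \<rho> ^ DIM('a)) < (\<integral>\<^sup>+y\<in>ball x \<rho>. G y \<partial>lborel) + ennreal (\<mu> / 2 * \<rho> ^ DIM('a))" .
    have "ennreal (\<mu> / 2 * \<rho> ^ DIM('a)) < (\<integral>\<^sup>+y\<in>ball x \<rho>. G y \<partial>lborel)"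
    proof (rule ccontr)
      assume "\<not> ?thesis"
      then have "(\<integral>\<^sup>+y\<in>ball x \<rho>. G y \<partial>lborel) + ennreal (\<mu> / 2 * \<rho> ^ DIM('a)) \<le>
          ennreal (\<mu> / 2 * \<rho> ^ DIM('a)) + ennreal (\<mu> / 2 * \<rho> ^ DIM('a))"
        by (intro add_right_mono) simp
      also have "\<dots> = ennreal (\<mu> * \<rho> ^ DIM('a))"
        using \<mu> \<rho> by (subst ennreal_plus[symmetric]) auto
      finally show False using * by simp
    qed
    then show ?thesis using \<rho> by blast
  qed
  then have "emeasure lborel {x. ennreal \<mu> < maximal_average g x}
      \<le> ennreal (5 ^ DIM('a) * unit_ball_vol DIM('a) / (\<mu> / 2)) * (\<integral>\<^sup>+y. G y \<partial>lborel)"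
    using \<mu> by (intro maximal_weak_type) auto
  then show ?thesis by (simp add: G_def \<omega>_def mult_ac)
qed

lemma maximal_average_strong_type:
  assumes q: "1 < q"
  shows "\<exists>C\<ge>0. \<forall>g :: 'a::euclidean_space \<Rightarrow> real. g \<in> borel_measurable borel \<longrightarrow> (\<forall>x. 0 \<le> g x) \<longrightarrow>
    (\<integral>\<^sup>+x. ennreal (enn2real (maximal_average g x) powr q) \<partial>lborel) \<le>
      ennreal C * (\<integral>\<^sup>+x. ennreal (g x powr q) \<partial>lborel)"
proof -
  define \<omega> where "\<omega> = unit_ball_vol DIM('a)"
  have \<omega>: "0 < \<omega>" by (simp add: \<omega>_def unit_ball_vol_pos)
  define A where "A = 2 * 5 ^ DIM('a) * \<omega>"
  have A: "0 \<le> A" using \<omega> by (simp add: A_def)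
  have "(\<integral>\<^sup>+x. ennreal (enn2real (maximal_average g x) powr q) \<partial>lborel) \<le>
      ennreal (A * q * (1 / (2 * \<omega>)) powr (1 - q) / (q - 1)) * (\<integral>\<^sup>+x. ennreal (g x powr q) \<partial>lborel)"
    if [measurable]: "g \<in> borel_measurable borel" and g0: "\<forall>x. 0 \<le> g x" for g :: "'a \<Rightarrow> real"
  proof (rule layer_cake_powr_le)
    fix \<mu> :: real assume \<mu>: "0 < \<mu>"
    \<comment> \<open>Passing to \<open>enn2real\<close> can only shrink the superlevel set, since
      an infinite value becomes 0.\<close>
    have "{x. \<mu> < enn2real (maximal_average g x)} \<subseteq> {x. ennreal \<mu> < maximal_average g x}"
    proof safe
      fix x assume "\<mu> < enn2real (maximal_average g x)"
      then show "ennreal \<mu> < maximal_average g x"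
        using \<mu> by (cases "maximal_average g x") (auto simp: ennreal_less_iff)
    qed
    then have "emeasure lborel {x. \<mu> < enn2real (maximal_average g x)} \<le>
        emeasure lborel {x. ennreal \<mu> < maximal_average g x}"
      by (rule emeasure_mono) measurable
    also note maximal_average_weak_type[OF that(1) _ \<mu>]
    finally show "emeasure lborel {x. \<mu> < enn2real (maximal_average g x)} \<le> ennreal (A / \<mu>) *
        (\<integral>\<^sup>+x. ennreal (g x) * indicator {x. 1 / (2 * \<omega>) * \<mu> < g x} x \<partial>lborel)"
      using g0 by (simp add: A_def \<omega>_def)
  qed (use \<omega> A q g0 in auto)
  moreover have "0 \<le> A * q * (1 / (2 * \<omega>)) powr (1 - q) / (q - 1)" using A q by simp
  ultimately show ?thesis by blast
qed

subsection \<open>Averages against the dilates of a kernel\<close>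

lemma lborel_integral_affine:
  fixes f :: "'a::euclidean_space \<Rightarrow> complex"
  assumes [measurable]: "f \<in> borel_measurable borel" and c: "c \<noteq> 0"
  shows "(LINT z|lborel. f z) = (\<bar>c\<bar> ^ DIM('a)) *\<^sub>R (LINT y|lborel. f (t + c *\<^sub>R y))"
proof -
  have "(LINT z|lborel. f z) =
      (LINT z|density (distr lborel borel (\<lambda>y. t + c *\<^sub>R y)) (\<lambda>_. ennreal (\<bar>c\<bar> ^ DIM('a))). f z)"
    by (subst lborel_affine[OF c, of t]) (rule refl)
  also have "\<dots> = (LINT z|distr lborel borel (\<lambda>y. t + c *\<^sub>R y). (\<bar>c\<bar> ^ DIM('a)) *\<^sub>R f z)"
    by (rule integral_density) auto
  also have "\<dots> = (LINT y|lborel. (\<bar>c\<bar> ^ DIM('a)) *\<^sub>R f (t + c *\<^sub>R y))"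
    by (rule integral_distr) auto
  finally show ?thesis by simp
qed

text \<open>The working class of functions: boundedness gives integrability against the kernel and
  finite maximal functions, the Lipschitz condition gives convergence of the averages at small
  scales.\<close>

definition bounded_lipschitz :: "('a::metric_space \<Rightarrow> 'b::real_normed_vector) \<Rightarrow> bool" where
  "bounded_lipschitz g \<longleftrightarrow> bounded (range g) \<and> (\<exists>K. K-lipschitz_on UNIV g)"

lemma bounded_lipschitz_continuous:
  "bounded_lipschitz g \<Longrightarrow> continuous_on S g"
  by (meson bounded_lipschitz_def continuous_on_subset lipschitz_on_continuous_on subset_UNIV)

lemma bounded_lipschitz_measurable:
  fixes g :: "'a::euclidean_space \<Rightarrow> 'b::real_normed_vector"
  shows "bounded_lipschitz g \<Longrightarrow> g \<in> borel_measurable borel"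
  by (simp add: borel_measurable_continuous_onI bounded_lipschitz_continuous)

lemma bounded_lipschitz_bound:
  assumes "bounded_lipschitz g"
  obtains B where "0 < B" "\<And>x. norm (g x) \<le> B"
  using assms unfolding bounded_lipschitz_def bounded_pos by auto

lemma one_less_norm_scaleR: "0 < t \<Longrightarrow> t < norm v \<Longrightarrow> 1 < norm ((1 / t) *\<^sub>R v)"
  for t :: real
  by simp

lemma norm_add_add_diff_diff_le:
  fixes a b c d :: "'a::real_normed_vector"
  shows "norm (a + b - c - d) \<le> norm a + norm b + norm c + norm d"
  using norm_triangle_ineq4[of "a + b - c" d] norm_triangle_ineq4[of "a + b" c] norm_triangle_ineq[of a b]
  by linarith

text \<open>The form in which every kernel estimate is used: a sup bound for the kernel times the
  mass of the function on the support.\<close>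

lemma norm_integral_mult_le:
  fixes a \<kappa> :: "'a::euclidean_space \<Rightarrow> 'b::{real_normed_div_algebra, banach, second_countable_topology}"
  assumes \<kappa>: "\<And>z. norm (\<kappa> z) \<le> c" "\<And>z. z \<notin> S \<Longrightarrow> \<kappa> z = 0"
    and V: "(\<integral>\<^sup>+z\<in>S. ennreal (norm (a z)) \<partial>lborel) \<le> ennreal V" "0 \<le> V"
    and [measurable]: "a \<in> borel_measurable borel" "S \<in> sets borel"
  shows "norm (LINT z|lborel. a z * \<kappa> z) \<le> c * V"
proof (cases "integrable lborel (\<lambda>z. a z * \<kappa> z)")
  case True
  have c: "0 \<le> c" using \<kappa>(1)[of 0] norm_ge_zero[of "\<kappa> 0"] by linarith
  have "ennreal (norm (LINT z|lborel. a z * \<kappa> z)) \<le> (\<integral>\<^sup>+z. ennreal (norm (a z * \<kappa> z)) \<partial>lborel)"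
    by (rule integral_norm_bound_ennreal[OF True])
  also have "\<dots> \<le> (\<integral>\<^sup>+z. ennreal c * (ennreal (norm (a z)) * indicator S z) \<partial>lborel)"
  proof (intro nn_integral_mono)
    fix z
    show "ennreal (norm (a z * \<kappa> z)) \<le> ennreal c * (ennreal (norm (a z)) * indicator S z)"
    proof (cases "z \<in> S")
      case True
      have "norm (a z * \<kappa> z) \<le> c * norm (a z)"
        unfolding norm_mult using mult_left_mono[OF \<kappa>(1), of "norm (a z)" z] by (simp add: mult.commute)
      then show ?thesis using True c by (simp add: ennreal_mult[symmetric] ennreal_leI)
    qed (simp add: \<kappa>(2))
  qed
  also have "\<dots> = ennreal c * (\<integral>\<^sup>+z\<in>S. ennreal (norm (a z)) \<partial>lborel)"
    by (rule nn_integral_cmult) measurable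
  also have "\<dots> \<le> ennreal c * ennreal V" by (intro mult_left_mono V) auto
  finally show ?thesis using c V(2) by (simp add: ennreal_mult[symmetric])
next
  \<comment> \<open>The Bochner integral of a non-integrable function is 0 by convention, so only
    the sign of the bound is at stake.\<close>
  case False
  moreover have "0 \<le> c" using \<kappa>(1)[of 0] norm_ge_zero[of "\<kappa> 0"] by linarith
  ultimately show ?thesis using V(2) by (simp add: not_integrable_integral_eq)
qed

text \<open>What the estimates take from a Hardy kernel. Its values are complex, so bounds go
  through the L1 norm \<open>mass\<close> instead of positivity; the Lipschitz constant is the
  source of the gain in the oscillation estimates.\<close>

locale averaging_kernel =
  fixes \<psi> :: "'a::euclidean_space \<Rightarrow> complex" and L :: real
  assumes lipschitz: "L-lipschitz_on UNIV \<psi>"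
    and zero_outside: "1 < norm y \<Longrightarrow> \<psi> y = 0"
    and integral_one: "(LINT y|lborel. \<psi> y) = 1"
begin

lemma L_nonneg: "0 \<le> L"
  using lipschitz lipschitz_on_nonneg by blast

lemma measurable_kernel [measurable]: "\<psi> \<in> borel_measurable borel"
  using lipschitz by (intro borel_measurable_continuous_onI lipschitz_on_continuous_on)

lemma norm_kernel_diff_le: "norm (\<psi> x - \<psi> y) \<le> L * norm (x - y)"
  using lipschitz by (auto simp: lipschitz_on_def dist_norm)

text \<open>A shift of length 3 moves any point of the unit ball out of it, where the kernel
  vanishes; the Lipschitz bound over that distance controls the value.\<close>

lemma norm_kernel_le: "norm (\<psi> y) \<le> 3 * L"
proof (cases "norm y \<le> 1")
  case True
  obtain b :: 'a where b: "b \<in> Basis" using nonempty_Basis by blast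
  have "norm (3 *\<^sub>R b) \<le> norm (y + 3 *\<^sub>R b) + norm y"
    by (metis add_diff_cancel_left' norm_triangle_ineq4)
  then have "1 < norm (y + 3 *\<^sub>R b)" using True b by simp
  then have "norm (\<psi> y) = norm (\<psi> y - \<psi> (y + 3 *\<^sub>R b))" by (simp add: zero_outside)
  also have "\<dots> \<le> L * norm (y - (y + 3 *\<^sub>R b))" by (rule norm_kernel_diff_le)
  finally show ?thesis using b by simp
qed (simp add: zero_outside L_nonneg)

lemma integrable_kernel: "integrable lborel \<psi>"
proof -
  have "set_integrable lborel (cball 0 1) \<psi>"
    unfolding set_integrable_def
    using lipschitz by (intro borel_integrable_compact) (auto intro: lipschitz_on_continuous_on lipschitz_on_subset)
  moreover have "indicator (cball 0 1) y *\<^sub>R \<psi> y = \<psi> y" for y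
    using zero_outside[of y] by (auto simp: indicator_def)
  ultimately show ?thesis by (simp add: set_integrable_def)
qed

definition mass :: real where "mass = (LINT y|lborel. norm (\<psi> y))"

lemma mass_nonneg: "0 \<le> mass"
  by (simp add: mass_def)

lemma norm_integral_kernel_le:
  assumes "\<And>y. norm y \<le> 1 \<Longrightarrow> norm (h y) \<le> b"
  shows "norm (LINT y|lborel. \<psi> y * h y) \<le> mass * b"
proof -
  have "norm (h 0) \<le> b" by (rule assms) simp
  then have b: "0 \<le> b" using norm_ge_zero order_trans by blast
  have "norm (LINT y|lborel. \<psi> y * h y) \<le> (LINT y|lborel. norm (\<psi> y * h y))"
    by (rule integral_norm_bound)
  also have "\<dots> \<le> (LINT y|lborel. norm (\<psi> y) * b)"
  proof (rule integral_mono')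
    show "integrable lborel (\<lambda>y. norm (\<psi> y) * b)"
      by (intro integrable_mult_left integrable_norm integrable_kernel)
    show "norm (\<psi> y * h y) \<le> norm (\<psi> y) * b" for y
      using assms[of y] zero_outside[of y]
      by (cases "norm y \<le> 1") (auto simp: norm_mult intro: mult_left_mono)
  qed (simp add: b)
  finally show ?thesis by (simp add: mass_def)
qed

text \<open>The convolution of g with the dilated kernel after the substitution that fixes the
  kernel and puts the scale into g. In this form regularity of g passes to the average
  directly.\<close>

definition avg :: "real \<Rightarrow> ('a \<Rightarrow> complex) \<Rightarrow> 'a \<Rightarrow> complex" where
  "avg s g x = (LINT y|lborel. \<psi> y * g (x - s *\<^sub>R y))"

lemma integrable_avg:
  assumes "bounded_lipschitz g"
  shows "integrable lborel (\<lambda>y. \<psi> y * g (x - s *\<^sub>R y))"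
proof -
  have [measurable]: "g \<in> borel_measurable borel" using assms by (rule bounded_lipschitz_measurable)
  obtain B where "\<And>x. norm (g x) \<le> B" using bounded_lipschitz_bound[OF assms] by blast
  then have "norm (\<psi> y * g (x - s *\<^sub>R y)) \<le> norm (\<psi> y * complex_of_real B)" for y
    by (smt (verit) mult_left_mono norm_ge_zero norm_mult norm_of_real)
  then show ?thesis
    by (intro Bochner_Integration.integrable_bound[OF integrable_mult_left[OF integrable_kernel, of "complex_of_real B"]]) auto
qed

text \<open>Integral one lets a constant be moved under the average.\<close>

lemma avg_diff_const:
  assumes "bounded_lipschitz g"
  shows "c - avg s g x = (LINT y|lborel. \<psi> y * (c - g (x - s *\<^sub>R y)))"
proof -
  have "(LINT y|lborel. \<psi> y * (c - g (x - s *\<^sub>R y))) =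
      (LINT y|lborel. \<psi> y * c - \<psi> y * g (x - s *\<^sub>R y))"
    by (simp add: right_diff_distrib)
  also have "\<dots> = (LINT y|lborel. \<psi> y * c) - (LINT y|lborel. \<psi> y * g (x - s *\<^sub>R y))"
    by (intro Bochner_Integration.integral_diff integrable_avg assms integrable_mult_left integrable_kernel)
  finally show ?thesis by (simp add: avg_def integral_one)
qed

lemma avg_diff:
  assumes "bounded_lipschitz g"
  shows "avg s g x - avg s g x' = (LINT y|lborel. \<psi> y * (g (x - s *\<^sub>R y) - g (x' - s *\<^sub>R y)))"
  unfolding avg_def right_diff_distrib
  by (intro Bochner_Integration.integral_diff[symmetric] integrable_avg assms)

lemma norm_avg_le: "(\<And>x. norm (g x) \<le> B) \<Longrightarrow> norm (avg s g x) \<le> mass * B"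
  unfolding avg_def by (intro norm_integral_kernel_le) auto

lemma norm_sub_avg_le:
  assumes "bounded_lipschitz g" "\<And>y. norm y \<le> 1 \<Longrightarrow> norm (g x - g (x - s *\<^sub>R y)) \<le> b"
  shows "norm (g x - avg s g x) \<le> mass * b"
  unfolding avg_diff_const[OF assms(1)] by (intro norm_integral_kernel_le assms(2))

lemma avg_lipschitz:
  assumes "bounded_lipschitz g" "K-lipschitz_on UNIV g"
  shows "(mass * K)-lipschitz_on UNIV (avg s g)"
proof (rule lipschitz_onI)
  fix x x' :: 'a
  have "norm (g (x - s *\<^sub>R y) - g (x' - s *\<^sub>R y)) \<le> K * dist x x'" for y
    using lipschitz_onD[OF assms(2), of "x - s *\<^sub>R y" "x' - s *\<^sub>R y"] by (simp add: dist_norm)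
  then show "dist (avg s g x) (avg s g x') \<le> mass * K * dist x x'"
    unfolding dist_norm avg_diff[OF assms(1)] mult.assoc by (intro norm_integral_kernel_le) (simp add: dist_norm)
qed (use mass_nonneg lipschitz_on_nonneg[OF assms(2)] in simp)

lemma bounded_lipschitz_avg [intro]:
  assumes "bounded_lipschitz g"
  shows "bounded_lipschitz (avg s g)"
proof -
  obtain B where "\<And>x. norm (g x) \<le> B" using bounded_lipschitz_bound[OF assms] by blast
  then have "bounded (range (avg s g))" by (auto intro!: boundedI norm_avg_le)
  then show ?thesis using avg_lipschitz[OF assms] assms unfolding bounded_lipschitz_def by blast
qed

text \<open>Fubini: both sides are iterated integrals of the function \<open>f y z\<close> below, in
  opposite orders. Absolute integrability comes from the bound on g and the finite
  \<open>mass\<close>.\<close>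

lemma avg_commute:
  assumes "bounded_lipschitz g"
  shows "avg s (avg t g) = avg t (avg s g)"
proof
  fix x
  have [measurable]: "g \<in> borel_measurable borel" using assms by (rule bounded_lipschitz_measurable)
  define f where "f y z = \<psi> y * (\<psi> z * g (x - s *\<^sub>R y - t *\<^sub>R z))" for y z
  obtain B where B: "\<And>x. norm (g x) \<le> B" using bounded_lipschitz_bound[OF assms] by blast
  have int1: "integrable lborel (\<lambda>z. f y z)" for y
    unfolding f_def by (intro integrable_mult_right integrable_avg assms)
  have "integrable (lborel \<Otimes>\<^sub>M lborel) (case_prod f)"
  proof (rule lborel_pair.Fubini_integrable)
    show meas: "case_prod f \<in> borel_measurable (lborel \<Otimes>\<^sub>M lborel)"
      unfolding f_def by measurable
    show "AE y in lborel. integrable lborel (\<lambda>z. case_prod f (y, z))" using int1 by simp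
    have le: "(LINT z|lborel. norm (f y z)) \<le> norm (\<psi> y) * (mass * B)" for y
    proof -
      have "(LINT z|lborel. norm (f y z)) \<le> (LINT z|lborel. norm (\<psi> y) * (norm (\<psi> z) * B))"
      proof (rule integral_mono)
        show "integrable lborel (\<lambda>z. norm (f y z))" using int1 by (rule integrable_norm)
        show "integrable lborel (\<lambda>z. norm (\<psi> y) * (norm (\<psi> z) * B))"
          by (intro integrable_mult_left integrable_mult_right integrable_norm integrable_kernel)
        show "norm (f y z) \<le> norm (\<psi> y) * (norm (\<psi> z) * B)" for z
          unfolding f_def norm_mult by (intro mult_left_mono B) auto
      qed
      then show ?thesis by (simp add: mass_def)
    qed
    have "integrable lborel (\<lambda>y. norm (\<psi> y) * (mass * B))"
      by (intro integrable_mult_left integrable_norm integrable_kernel)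
    moreover have "(\<lambda>y. LINT z|lborel. norm (f y z)) \<in> borel_measurable lborel"
    proof -
      have "(\<lambda>(y, z). norm (f y z)) \<in> borel_measurable (lborel \<Otimes>\<^sub>M lborel)"
        unfolding f_def by measurable
      from lborel.borel_measurable_lebesgue_integral[OF this] show ?thesis by simp
    qed
    ultimately have "integrable lborel (\<lambda>y. LINT z|lborel. norm (f y z))"
      by (rule Bochner_Integration.integrable_bound) (use le in \<open>auto intro!: AE_I2 order_trans[OF _ abs_ge_self]\<close>)
    then show "integrable lborel (\<lambda>y. LINT z|lborel. norm (case_prod f (y, z)))" by simp
  qed
  from lborel_pair.Fubini_integral[OF this]
  have "(LINT z|lborel. LINT y|lborel. f y z) = (LINT y|lborel. LINT z|lborel. f y z)" .
  moreover have "avg s (avg t g) x = (LINT y|lborel. LINT z|lborel. f y z)"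
    unfolding avg_def f_def by simp
  moreover have "avg t (avg s g) x = (LINT z|lborel. LINT y|lborel. f y z)"
  proof -
    have "(LINT y|lborel. f y z) = \<psi> z * (LINT y|lborel. \<psi> y * g (x - t *\<^sub>R z - s *\<^sub>R y))" for z
    proof -
      have "(LINT y|lborel. f y z) = (LINT y|lborel. \<psi> z * (\<psi> y * g (x - t *\<^sub>R z - s *\<^sub>R y)))"
        unfolding f_def by (intro Bochner_Integration.integral_cong refl) (simp add: algebra_simps)
      then show ?thesis by (simp only: integral_mult_right_zero)
    qed
    then show ?thesis by (simp only: avg_def)
  qed
  ultimately show "avg s (avg t g) x = avg t (avg s g) x" by simp
qed

text \<open>A J-Lipschitz function differs from its average at scale a by at most
  \<open>mass * (J * a)\<close>. For the double average this is applied to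
  \<open>avg (s k) g\<close>, whose Lipschitz constant \<open>mass * K\<close> does not depend on
  the scale.\<close>

lemma avg_tendsto:
  assumes g: "bounded_lipschitz g" and s: "s \<longlonglongrightarrow> 0" "\<And>k. 0 \<le> s k"
  shows "(\<lambda>k. avg (s k) g x) \<longlonglongrightarrow> g x" "(\<lambda>k. avg (s k) (avg (s k) g) x) \<longlonglongrightarrow> g x"
proof -
  obtain K where K: "K-lipschitz_on UNIV g" using g by (auto simp: bounded_lipschitz_def)
  have *: "norm (h x - avg a h x) \<le> mass * (J * a)"
    if "bounded_lipschitz h" "J-lipschitz_on UNIV h" "0 \<le> a" for h J a
  proof (rule norm_sub_avg_le[OF that(1)])
    fix y :: 'a assume y: "norm y \<le> 1"
    have "norm (h x - h (x - a *\<^sub>R y)) \<le> J * norm (a *\<^sub>R y)"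
      using lipschitz_onD[OF that(2), of x "x - a *\<^sub>R y"] by (simp add: dist_norm)
    also have "\<dots> \<le> J * a"
      using that(3) y lipschitz_on_nonneg[OF that(2)] by (intro mult_left_mono) (auto intro: mult_left_le)
    finally show "norm (h x - h (x - a *\<^sub>R y)) \<le> J * a" .
  qed
  have t1: "(\<lambda>k. g x - avg (s k) g x) \<longlonglongrightarrow> 0"
    by (rule Lim_null_comparison[where g = "\<lambda>k. mass * (K * s k)"])
       (use *[OF g K s(2)] in simp, auto intro!: tendsto_eq_intros s)
  then show 1: "(\<lambda>k. avg (s k) g x) \<longlonglongrightarrow> g x"
    using tendsto_diff[OF tendsto_const[of "g x"] t1] by simp
  have t2: "(\<lambda>k. avg (s k) g x - avg (s k) (avg (s k) g) x) \<longlonglongrightarrow> 0"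
    by (rule Lim_null_comparison[where g = "\<lambda>k. mass * (mass * K * s k)"])
       (use *[OF bounded_lipschitz_avg[OF g] avg_lipschitz[OF g K] s(2)] in simp,
         auto intro!: tendsto_eq_intros s)
  show "(\<lambda>k. avg (s k) (avg (s k) g) x) \<longlonglongrightarrow> g x"
    using tendsto_diff[OF 1 t2] by simp
qed

text \<open>In 5 K/(1 - \<theta>), one K comes from the start \<open>T 0\<close> and 4 K \<theta>^k
  from each of the later differences; the bound for \<open>T n\<close> passes to the limit
  \<open>g x\<close>.\<close>

lemma norm_le_avg_telescope:
  assumes g: "bounded_lipschitz g" and t: "0 < t" and K: "0 \<le> K" and \<theta>: "0 \<le> \<theta>" "\<theta> < 1"
    and step: "\<And>k s. 0 < s \<Longrightarrow> s \<le> t \<Longrightarrow> s \<le> 2 * t / 2 ^ k \<Longrightarrow>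
      norm (avg (t / 2 ^ k) g x - avg s (avg (t / 2 ^ k) g) x) \<le> K * \<theta> ^ k"
  shows "norm (g x) \<le> norm (avg t g x) + 5 * K / (1 - \<theta>)"
proof -
  define P where "P k = avg (t / 2 ^ k)" for k :: nat
  define T where "T k = 2 * P k g x - P k (P k g) x" for k
  have s0: "(\<lambda>k. t / 2 ^ k) \<longlonglongrightarrow> 0"
    using tendsto_mult_right_zero[OF LIMSEQ_power_zero[of "1 / 2 :: real"], of t]
    by (simp add: power_divide)
  have "T \<longlonglongrightarrow> 2 * g x - g x"
    unfolding T_def P_def using t by (intro tendsto_intros avg_tendsto[OF g s0]) auto
  then have lim: "T \<longlonglongrightarrow> g x" by simp
  \<comment> \<open>The index k may exceed i by one: the average at a scale is also compared with
    the next coarser one. This is why \<open>step\<close> admits s up to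
    \<open>2 * t / 2 ^ k\<close>.\<close>
  have R: "norm (P k g x - P i (P k g) x) \<le> K * \<theta> ^ k" if "k \<le> Suc i" for i k
    unfolding P_def
  proof (rule step)
    show "t / 2 ^ i \<le> t" using t by (simp add: divide_le_eq)
    have "(2::real) ^ k \<le> 2 ^ Suc i" by (rule power_increasing[OF that]) simp
    then show "t / 2 ^ i \<le> 2 * t / 2 ^ k" using t by (simp add: field_simps)
  qed (use t in simp)
  have T0: "norm (T 0) \<le> norm (avg t g x) + K"
  proof -
    have "T 0 = P 0 g x + (P 0 g x - P 0 (P 0 g) x)" by (simp add: T_def)
    then have "norm (T 0) \<le> norm (P 0 g x) + norm (P 0 g x - P 0 (P 0 g) x)"
      using norm_triangle_ineq by metis
    then show ?thesis using R[of 0 0] by (simp add: P_def)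
  qed
  have Tstep: "norm (T (Suc k) - T k) \<le> 4 * K * \<theta> ^ k" for k
  proof -
    have "P k (P (Suc k) g) x = P (Suc k) (P k g) x"
      unfolding P_def using avg_commute[OF g] by metis
    \<comment> \<open>The two mixed products enter with opposite signs and cancel by
      commutativity.\<close>
    then have eq: "T (Suc k) - T k = (P (Suc k) g x - P (Suc k) (P (Suc k) g) x) + (P (Suc k) g x - P k (P (Suc k) g) x)
      - (P k g x - P (Suc k) (P k g) x) - (P k g x - P k (P k g) x)"
      by (simp add: T_def)
    have "norm (T (Suc k) - T k) \<le> norm (P (Suc k) g x - P (Suc k) (P (Suc k) g) x) + norm (P (Suc k) g x - P k (P (Suc k) g) x)
      + norm (P k g x - P (Suc k) (P k g) x) + norm (P k g x - P k (P k g) x)"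
      unfolding eq by (rule norm_add_add_diff_diff_le)
    also have "\<dots> \<le> K * \<theta> ^ Suc k + K * \<theta> ^ Suc k + K * \<theta> ^ k + K * \<theta> ^ k"
      by (intro add_mono R) simp_all
    also have "\<dots> \<le> 4 * K * \<theta> ^ k"
    proof -
      have "\<theta> ^ Suc k \<le> \<theta> ^ k" using \<theta> by (intro power_decreasing) auto
      then have "K * \<theta> ^ Suc k \<le> K * \<theta> ^ k" using K by (rule mult_left_mono)
      then show ?thesis by linarith
    qed
    finally show ?thesis .
  qed
  have Tn: "norm (T n) \<le> norm (avg t g x) + K + 4 * K * (\<Sum>k<n. \<theta> ^ k)" for n
  proof (induction n)
    case (Suc n)
    have "norm (T (Suc n)) \<le> norm (T n) + norm (T (Suc n) - T n)"
      by (rule norm_triangle_sub)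
    also have "\<dots> \<le> norm (avg t g x) + K + 4 * K * (\<Sum>k<n. \<theta> ^ k) + 4 * K * \<theta> ^ n"
      using Suc Tstep by (intro add_mono)
    finally show ?case by (simp add: algebra_simps)
  qed (use T0 in simp)
  have "norm (T n) \<le> norm (avg t g x) + 5 * K / (1 - \<theta>)" for n
  proof -
    have "(\<Sum>k<n. \<theta> ^ k) \<le> 1 / (1 - \<theta>)"
      using \<theta> by (simp add: sum_gp_strict divide_right_mono)
    then have "4 * K * (\<Sum>k<n. \<theta> ^ k) \<le> 4 * K * (1 / (1 - \<theta>))"
      using K by (intro mult_left_mono) auto
    moreover have "K * 1 \<le> K * (1 / (1 - \<theta>))"
      using K \<theta> by (intro mult_left_mono) (auto simp: field_simps)
    moreover have "K * (1 / (1 - \<theta>)) + 4 * K * (1 / (1 - \<theta>)) = 5 * K / (1 - \<theta>)"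
      by (simp add: add_divide_distrib[symmetric])
    ultimately show ?thesis using Tn[of n] by linarith
  qed
  then show ?thesis
    using tendsto_norm[OF lim] by (intro LIMSEQ_le_const2) auto
qed

text \<open>Here x occurs only in the kernel, so moving x costs the Lipschitz constant of the kernel
  and asks nothing of g. It is also the form in which the Hardy norm is defined.\<close>

lemma avg_eq_integral_dilated:
  assumes "bounded_lipschitz g" and t: "0 < t"
  shows "avg t g x = (LINT z|lborel. g z * ((1 / t ^ DIM('a)) *\<^sub>R \<psi> ((1 / t) *\<^sub>R (x - z))))"
proof -
  have [measurable]: "g \<in> borel_measurable borel" using assms(1) by (rule bounded_lipschitz_measurable)
  have "(LINT z|lborel. g z * ((1 / t ^ DIM('a)) *\<^sub>R \<psi> ((1 / t) *\<^sub>R (x - z)))) =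
      (\<bar>- t\<bar> ^ DIM('a)) *\<^sub>R (LINT y|lborel. g (x + (- t) *\<^sub>R y) *
        ((1 / t ^ DIM('a)) *\<^sub>R \<psi> ((1 / t) *\<^sub>R (x - (x + (- t) *\<^sub>R y)))))"
    using t by (intro lborel_integral_affine) auto
  also have "\<dots> = (LINT y|lborel. \<psi> y * g (x - t *\<^sub>R y))"
    using t by (simp add: mult.commute)
  finally show ?thesis by (simp add: avg_def)
qed

lemma norm_avg_le_ball:
  assumes a: "bounded_lipschitz a" and t: "0 < t"
    and V: "(\<integral>\<^sup>+z\<in>ball x (3 * t). ennreal (norm (a z)) \<partial>lborel) \<le> ennreal V" "0 \<le> V"
  shows "norm (avg t a x) \<le> 3 * L / t ^ DIM('a) * V"
  unfolding avg_eq_integral_dilated[OF a t]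
proof (rule norm_integral_mult_le[OF _ _ V])
  fix z
  show "norm ((1 / t ^ DIM('a)) *\<^sub>R \<psi> ((1 / t) *\<^sub>R (x - z))) \<le> 3 * L / t ^ DIM('a)"
    using norm_kernel_le t by (simp add: divide_right_mono)
  assume "z \<notin> ball x (3 * t)"
  then have "3 * t \<le> norm (x - z)" by (simp add: dist_norm)
  then have "1 < norm ((1 / t) *\<^sub>R (x - z))" using t by (intro one_less_norm_scaleR) auto
  then show "(1 / t ^ DIM('a)) *\<^sub>R \<psi> ((1 / t) *\<^sub>R (x - z)) = 0" by (simp add: zero_outside)
qed (use bounded_lipschitz_measurable[OF a] in auto)

text \<open>Shifting x by at most s changes the kernel dilated by t by at most L (s/t)/t^n. As s is
  at most t, both kernels live within distance 2t of x, inside the ball of radius 3t.\<close>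

lemma norm_avg_sub_avg_avg_le:
  assumes a: "bounded_lipschitz a" and s: "0 < s" "s \<le> t"
    and V: "(\<integral>\<^sup>+z\<in>ball x (3 * t). ennreal (norm (a z)) \<partial>lborel) \<le> ennreal V" "0 \<le> V"
  shows "norm (avg t a x - avg s (avg t a) x) \<le> mass * (L * (s / t) / t ^ DIM('a) * V)"
proof (rule norm_sub_avg_le[OF bounded_lipschitz_avg[OF a]])
  have t: "0 < t" using s by simp
  have [measurable]: "a \<in> borel_measurable borel" using a by (rule bounded_lipschitz_measurable)
  fix y :: 'a assume y: "norm y \<le> 1"
  define x' where "x' = x - s *\<^sub>R y"
  have xx': "norm (x - x') \<le> s" using s y by (simp add: x'_def mult_left_le)
  define k where "k w z = (1 / t ^ DIM('a)) *\<^sub>R \<psi> ((1 / t) *\<^sub>R (w - z))" for w z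
  have k_meas [measurable]: "k w \<in> borel_measurable borel" for w
    unfolding k_def by measurable
  have int: "integrable lborel (\<lambda>z. a z * k w z)" for w
  proof -
    obtain B where B: "\<And>x. norm (a x) \<le> B" using bounded_lipschitz_bound[OF a] by blast
    have k0: "k w z = 0" if "z \<notin> cball w t" for z
    proof -
      have "1 < norm ((1 / t) *\<^sub>R (w - z))" 
        using t that by (intro one_less_norm_scaleR) (auto simp: dist_norm)
      then show ?thesis by (simp add: k_def zero_outside)
    qed
    have kb: "norm (k w z) \<le> 3 * L / t ^ DIM('a)" for z
      using norm_kernel_le t by (simp add: k_def divide_right_mono)
    have "integrable lborel (\<lambda>z. indicator (cball w t) z *\<^sub>R (B * (3 * L / t ^ DIM('a))))"
      by (intro integrable_indicator) (auto intro: emeasure_bounded_finite[unfolded infinity_ennreal_def])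
    then show ?thesis
    proof (rule Bochner_Integration.integrable_bound)
      show "AE z in lborel. norm (a z * k w z) \<le> norm (indicator (cball w t) z *\<^sub>R (B * (3 * L / t ^ DIM('a))))"
      proof (intro AE_I2)
        fix z
        show "norm (a z * k w z) \<le> norm (indicator (cball w t) z *\<^sub>R (B * (3 * L / t ^ DIM('a))))"
        proof (cases "z \<in> cball w t")
          case True
          have "norm (a z * k w z) \<le> B * (3 * L / t ^ DIM('a))"
            unfolding norm_mult using B[of z] order_trans[OF norm_ge_zero B] by (intro mult_mono kb) auto
          also have "\<dots> \<le> \<bar>B * (3 * L / t ^ DIM('a))\<bar>" by (rule abs_ge_self)
          finally show ?thesis using True by simp
        qed (simp add: k0)
      qed
    qed measurable
  qed
  have "avg t a x - avg t a x' = (LINT z|lborel. a z * k x z) - (LINT z|lborel. a z * k x' z)"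
    unfolding avg_eq_integral_dilated[OF a t] k_def ..
  also have "\<dots> = (LINT z|lborel. a z * (k x z - k x' z))"
    using int by (simp add: right_diff_distrib)
  also have "norm \<dots> \<le> L * (s / t) / t ^ DIM('a) * V"
  proof (rule norm_integral_mult_le[OF _ _ V])
    fix z
    have "norm (\<psi> ((1 / t) *\<^sub>R (x - z)) - \<psi> ((1 / t) *\<^sub>R (x' - z))) \<le>
        L * norm ((1 / t) *\<^sub>R (x - z) - (1 / t) *\<^sub>R (x' - z))"
      by (rule norm_kernel_diff_le)
    also have "(1 / t) *\<^sub>R (x - z) - (1 / t) *\<^sub>R (x' - z) = (1 / t) *\<^sub>R (x - x')"
      by (simp add: scaleR_right_diff_distrib[symmetric])
    also have "L * norm \<dots> \<le> L * (s / t)"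
      using xx' t by (intro mult_left_mono L_nonneg) (simp add: divide_right_mono)
    finally have "norm (\<psi> ((1 / t) *\<^sub>R (x - z)) - \<psi> ((1 / t) *\<^sub>R (x' - z))) / t ^ DIM('a) \<le>
        L * (s / t) / t ^ DIM('a)"
      by (rule divide_right_mono) (use t in simp)
    moreover have "norm (k x z - k x' z) =
        norm (\<psi> ((1 / t) *\<^sub>R (x - z)) - \<psi> ((1 / t) *\<^sub>R (x' - z))) / t ^ DIM('a)"
      unfolding k_def scaleR_right_diff_distrib[symmetric] norm_scaleR using t by simp
    ultimately show "norm (k x z - k x' z) \<le> L * (s / t) / t ^ DIM('a)" by simp
    assume "z \<notin> ball x (3 * t)"
    then have z: "3 * t \<le> norm (x - z)" by (simp add: dist_norm)
    also have "norm (x - z) \<le> norm (x - x') + norm (x' - z)"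
      using norm_triangle_ineq[of "x - x'" "x' - z"] by simp
    finally have "2 * t \<le> norm (x' - z)" using xx' s(2) by simp
    then have "1 < norm ((1 / t) *\<^sub>R (x - z))" "1 < norm ((1 / t) *\<^sub>R (x' - z))"
      using t z by (auto intro!: one_less_norm_scaleR simp del: norm_scaleR)
    then show "k x z - k x' z = 0" by (simp add: k_def zero_outside)
  qed auto
  finally show "norm (avg t a x - avg t a (x - s *\<^sub>R y)) \<le> L * (s / t) / t ^ DIM('a) * V"
    by (simp add: x'_def)
qed

subsection \<open>Vertical and Peetre maximal functions\<close>

text \<open>A real supremum, meaningful because the averages of a bounded function are bounded
  uniformly in s; it is linked to \<open>maximal_function\<close> below.\<close>

definition vertical_max :: "('a \<Rightarrow> complex) \<Rightarrow> 'a \<Rightarrow> real" where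
  "vertical_max f x = (SUP s\<in>{0<..}. norm (avg s f x))"

lemma bdd_above_avg:
  assumes "bounded_lipschitz f"
  shows "bdd_above ((\<lambda>s. norm (avg s f x)) ` A)"
proof -
  obtain B where "\<And>x. norm (f x) \<le> B" using bounded_lipschitz_bound[OF assms] by blast
  then show ?thesis by (intro bdd_aboveI2[where M = "mass * B"] norm_avg_le)
qed

lemma norm_avg_le_vertical_max:
  "bounded_lipschitz f \<Longrightarrow> 0 < s \<Longrightarrow> norm (avg s f x) \<le> vertical_max f x"
  unfolding vertical_max_def by (rule cSUP_upper) (auto intro: bdd_above_avg)

lemma vertical_max_nonneg: "bounded_lipschitz f \<Longrightarrow> 0 \<le> vertical_max f x"
  using norm_avg_le_vertical_max[of f 1 x] by (meson norm_ge_zero order_trans zero_less_one)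

lemma vertical_max_le: "(\<And>x. norm (f x) \<le> B) \<Longrightarrow> vertical_max f x \<le> mass * B"
  unfolding vertical_max_def by (rule cSUP_least) (auto intro: norm_avg_le)

text \<open>A supremum of continuous functions is lower semicontinuous: its superlevel sets are
  unions of open sets.\<close>

lemma borel_measurable_vertical_max:
  assumes f: "bounded_lipschitz f"
  shows "vertical_max f \<in> borel_measurable borel"
proof (rule borel_measurableI_greater)
  fix c
  have "{x. c < vertical_max f x} = (\<Union>s\<in>{0<..}. {x. c < norm (avg s f x)})"
    unfolding vertical_max_def by (subst less_cSUP_iff) (auto intro: bdd_above_avg[OF f])
  moreover have "open {x. c < norm (avg s f x)}" for s
    by (intro open_Collect_less continuous_intros bounded_lipschitz_continuous bounded_lipschitz_avg f)
  ultimately have "open {x. c < vertical_max f x}" by auto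
  then show "{x \<in> space borel. c < vertical_max f x} \<in> sets borel" by simp
qed

definition peetre_max :: "real \<Rightarrow> ('a \<Rightarrow> complex) \<Rightarrow> 'a \<Rightarrow> real" where
  "peetre_max N f x = (SUP (y, s)\<in>UNIV \<times> {0<..}. norm (avg s f y) * (1 + dist x y / s) powr (- N))"

lemma norm_avg_le_peetre_max:
  assumes f: "bounded_lipschitz f" and N: "0 \<le> N" and s: "0 < s"
  shows "norm (avg s f y) \<le> peetre_max N f x * (1 + dist x y / s) powr N"
proof -
  obtain B where B: "0 < B" "\<And>x. norm (f x) \<le> B" using bounded_lipschitz_bound[OF f] by blast
  have le: "norm (avg s f y) * (1 + dist x y / s) powr (- N) \<le> mass * B" if s: "0 < s" for s y
  proof -
    have "1 \<le> (1 + dist x y / s) powr N" using s N by (intro ge_one_powr_ge_zero) auto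
    then have "(1 + dist x y / s) powr (- N) \<le> 1" by (simp add: powr_minus inverse_le_1_iff)
    then have "norm (avg s f y) * (1 + dist x y / s) powr (- N) \<le> mass * B * 1"
      using B mass_nonneg by (intro mult_mono norm_avg_le) auto
    then show ?thesis by simp
  qed
  have "norm (avg s f y) * (1 + dist x y / s) powr (- N) \<le> peetre_max N f x"
    unfolding peetre_max_def
    by (rule cSUP_upper2[where x = "(y, s)"]) (use le s in \<open>auto intro!: bdd_aboveI2[where M = "mass * B"]\<close>)
  moreover have "0 < 1 + dist x y / s" using s by (simp add: add_pos_nonneg)
  ultimately show ?thesis by (simp add: powr_minus field_simps)
qed

lemma peetre_max_le:
  assumes "\<And>y s. 0 < s \<Longrightarrow> norm (avg s f y) \<le> b * (1 + dist x y / s) powr N"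
  shows "peetre_max N f x \<le> b"
  unfolding peetre_max_def
proof (rule cSUP_least)
  fix ys :: "'a \<times> real" assume "ys \<in> UNIV \<times> {0<..}"
  then obtain y s where ys: "ys = (y, s)" "0 < s" by auto
  have "0 < 1 + dist x y / s" using ys by (simp add: add_pos_nonneg)
  then show "(case ys of (y, s) \<Rightarrow> norm (avg s f y) * (1 + dist x y / s) powr (- N)) \<le> b"
    using assms[OF ys(2), of y] by (simp add: ys(1) powr_minus field_simps)
qed auto

lemma peetre_max_nonneg:
  assumes "bounded_lipschitz f" "0 \<le> N"
  shows "0 \<le> peetre_max N f x"
  using norm_avg_le_peetre_max[OF assms, of 1 x x] by simp (meson norm_ge_zero order_trans)

text \<open>The self-improvement argument of Fefferman--Stein and Stroemberg--Torchinsky. It needs the Peetre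
  maximal function to be finite, which is why \<open>f\<close> is assumed to be bounded.\<close>

lemma peetre_max_powr_le:
  fixes r :: real
  assumes r: "0 < r" "r < 1" and rn: "DIM('a) * (1 - r) / r < 1"
  shows "\<exists>C\<ge>0. \<forall>f x. bounded_lipschitz f \<longrightarrow>
    peetre_max (DIM('a) / r) f x powr r \<le> C * enn2real (maximal_average (\<lambda>z. vertical_max f z powr r) x)"
proof -
  define n where "n = DIM('a)"
  define N where "N = n / r"
  \<comment> \<open>Net ratio between consecutive scales: growth 2^(N (1-r)) from the Peetre weight
    against the gain 1/2 from the kernel. Hypothesis \<open>rn\<close> says that it is below
    1.\<close>
  define \<theta> where "\<theta> = 2 powr (N * (1 - r)) / 2"
  \<comment> \<open>3 L bounds the coarsest average; 10 = 5 * 2, with 5 from telescoping and 2 from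
    s/t \<le> 2/2^k. The powers of 4 and 6 come from the weight 4 D and from the ball radius 3 t D,
    doubled by the rational radii.\<close>
  define C where "C = (3 * L + 10 * mass * L / (1 - \<theta>)) * 4 powr (N * (1 - r)) * 6 ^ n"
  \<comment> \<open>By the last identity the weight D^(N (1-r)) and the volume factor D^n recombine
    to exactly the Peetre weight D^N.\<close>
  have N: "0 \<le> N" "N * (1 - r) < 1" "N * (1 - r) + n = N"
    using r rn by (auto simp: N_def n_def field_simps)
  have \<theta>: "0 \<le> \<theta>" "\<theta> < 1"
    using powr_less_mono[OF N(2), of 2] by (auto simp: \<theta>_def)
  have C: "0 \<le> C" using \<theta> L_nonneg mass_nonneg by (simp add: C_def)
  have "peetre_max N f x powr r \<le> C * enn2real (maximal_average (\<lambda>z. vertical_max f z powr r) x)"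
    if f: "bounded_lipschitz f" for f x
  proof -
    define P where "P = peetre_max N f x"
    define M where "M = (\<lambda>z. vertical_max f z powr r)"
    define H where "H = enn2real (maximal_average M x)"
    have P: "0 \<le> P" unfolding P_def by (rule peetre_max_nonneg[OF f N(1)])
    have H: "0 \<le> H" by (simp add: H_def)
    obtain B where B: "0 < B" "\<And>x. norm (f x) \<le> B" using bounded_lipschitz_bound[OF f] by blast
    have "maximal_average M x < \<infinity>"
      by (rule maximal_average_less_top[where b = "(mass * B) powr r"])
        (use vertical_max_le[of f B] B r vertical_max_nonneg[OF f] in \<open>auto simp: M_def intro!: powr_mono2\<close>)
    then have HL: "maximal_average M x = ennreal H" by (simp add: H_def less_top)
    have M_meas [measurable]: "M \<in> borel_measurable borel"
      unfolding M_def using borel_measurable_vertical_max[OF f] by measurable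
    have "norm (avg t f y) \<le> C * P powr (1 - r) * H * (1 + dist x y / t) powr N" if t: "0 < t" for t y
    proof -
      define D where "D = 1 + dist x y / t"
      have D: "1 \<le> D" using t by (simp add: D_def)
      define V where "V k = P powr (1 - r) * (2 ^ k * (4 * D)) powr (N * (1 - r)) * ((6 * t * D) ^ n * H)" for k :: nat
      have V0: "0 \<le> V k" for k using H t D by (simp add: V_def)
      have V: "(\<integral>\<^sup>+z\<in>ball y (3 * t). ennreal (norm (avg (t / 2 ^ k) f z)) \<partial>lborel) \<le> ennreal (V k)" for k
      proof -
        define c where "c = P powr (1 - r) * (2 ^ k * (4 * D)) powr (N * (1 - r))"
        have c: "0 \<le> c" by (simp add: c_def)
        have "norm (avg (t / 2 ^ k) f z) \<le> c * M z" if z: "z \<in> ball y (3 * t)" for z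
        proof -
          define a where "a = norm (avg (t / 2 ^ k) f z)"
          \<comment> \<open>The Peetre weight at scale t/2^k: the finer scale costs a factor 2^k,
            and the displacement of z from y, less than 3t, is absorbed by the factor 4.\<close>
          define w where "w = 1 + dist x z / (t / 2 ^ k)"
          have w: "0 \<le> w" using t by (simp add: w_def)
          have "dist x z \<le> dist x y + 3 * t"
            using z dist_triangle[of x z y] by simp
          then have "dist x z / t \<le> dist x y / t + 3"
            using t by (simp add: field_simps)
          then have "2 ^ k * (dist x z / t) \<le> 2 ^ k * (dist x y / t + 3)"
            by (rule mult_left_mono) simp
          moreover have "(1::real) \<le> 2 ^ k" by (rule one_le_power) simp
          ultimately have "1 + 2 ^ k * (dist x z / t) \<le> 2 ^ k + 2 ^ k * (dist x y / t + 3)"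
            by (rule add_mono[rotated])
          also have "\<dots> = 2 ^ k * (dist x y / t + 4)" by (simp add: algebra_simps)
          finally have "w \<le> 2 ^ k * (dist x y / t + 4)"
            by (simp add: w_def mult.commute)
          also have "\<dots> \<le> 2 ^ k * (4 * D)"
          proof (rule mult_left_mono)
            have *: "e + 4 \<le> 4 * (1 + e)" if "0 \<le> e" for e :: real using that by simp
            show "dist x y / t + 4 \<le> 4 * D" unfolding D_def by (rule *) (use t in simp)
          qed simp
          finally have wD: "w \<le> 2 ^ k * (4 * D)" .
          have "a \<le> P * w powr N"
            unfolding a_def P_def w_def using t by (intro norm_avg_le_peetre_max f N) simp
          then have "a powr (1 - r) \<le> (P * w powr N) powr (1 - r)"
            using r by (intro powr_mono2) (auto simp: a_def)
          also have "\<dots> = P powr (1 - r) * w powr (N * (1 - r))"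
            by (simp add: powr_mult powr_powr)
          also have "\<dots> \<le> c"
            unfolding c_def using r N(1) w wD by (intro mult_left_mono powr_mono2) auto
          finally have 1: "a powr (1 - r) \<le> c" .
          have 2: "a powr r \<le> M z"
            unfolding a_def M_def using t r by (intro powr_mono2 norm_avg_le_vertical_max f) auto
          have "a = a powr (1 - r) * a powr r"
            by (simp add: powr_add[symmetric] a_def)
          also have "\<dots> \<le> c * M z" using 1 2 c by (intro mult_mono) auto
          finally show ?thesis by (simp add: a_def)
        qed
        then have "(\<integral>\<^sup>+z\<in>ball y (3 * t). ennreal (norm (avg (t / 2 ^ k) f z)) \<partial>lborel) \<le>
            (\<integral>\<^sup>+z. ennreal c * (ennreal (M z) * indicator (ball y (3 * t)) z) \<partial>lborel)"
          using c by (intro nn_integral_mono)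
            (auto simp: indicator_def ennreal_mult[symmetric] M_def intro!: ennreal_leI)
        also have "\<dots> \<le> (\<integral>\<^sup>+z. ennreal c * (ennreal (M z) * indicator (ball x (3 * t * D)) z) \<partial>lborel)"
        proof -
          \<comment> \<open>Recentring at x, where the maximal function is evaluated, costs a factor
            D in the radius.\<close>
          have "ball y (3 * t) \<subseteq> ball x (3 * t * D)"
          proof
            fix z assume z: "z \<in> ball y (3 * t)"
            have "dist x z < dist x y + 3 * t" using z dist_triangle[of x z y] by simp
            also have "\<dots> \<le> 3 * t * D" using t by (simp add: D_def field_simps)
            finally show "z \<in> ball x (3 * t * D)" by simp
          qed
          then show ?thesis by (intro nn_integral_mono mult_left_mono) (auto simp: indicator_def)
        qed
        also have "\<dots> = ennreal c * (\<integral>\<^sup>+z\<in>ball x (3 * t * D). ennreal (M z) \<partial>lborel)"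
          by (rule nn_integral_cmult) (auto intro!: borel_measurable_times_ennreal borel_measurable_indicator)
        also have "\<dots> \<le> ennreal c * (ennreal ((2 * (3 * t * D)) ^ n) * maximal_average M x)"
          unfolding n_def using t D by (intro mult_left_mono nn_integral_ball_le_maximal_average) auto
        also have "\<dots> = ennreal (V k)"
          unfolding HL V_def c_def[symmetric] using c H t D
          by (simp add: ennreal_mult[symmetric] mult.assoc[symmetric])
        finally show ?thesis .
      qed
      define K where "K = 2 * mass * L / t ^ n * V 0"
      have K: "0 \<le> K" using V0 mass_nonneg L_nonneg t by (simp add: K_def)
      have Vk: "V k = (2 powr (N * (1 - r))) ^ k * V 0" for k
      proof -
        have "((2::real) ^ k) powr (N * (1 - r)) = (2 powr (N * (1 - r))) ^ k"
          by (simp add: powr_realpow[symmetric] powr_powr mult.commute)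
        then show ?thesis
          using D by (simp add: V_def powr_mult)
      qed
      have "norm (avg t f y) \<le> norm (avg t (avg t f) y) + 5 * K / (1 - \<theta>)"
      proof (rule norm_le_avg_telescope[OF bounded_lipschitz_avg[OF f] t K \<theta>])
        fix k and s :: real assume s: "0 < s" "s \<le> t" "s \<le> 2 * t / 2 ^ k"
        \<comment> \<open>Commuting puts the coarse average outside. Its kernel at scale t then
          absorbs the shift by s, which gives the factor s/t, while the fine average enters only
          through its mass.\<close>
        have "norm (avg (t / 2 ^ k) (avg t f) y - avg s (avg (t / 2 ^ k) (avg t f)) y) =
            norm (avg t (avg (t / 2 ^ k) f) y - avg s (avg t (avg (t / 2 ^ k) f)) y)"
          by (simp only: avg_commute[OF f, of t "t / 2 ^ k"])
        also have "\<dots> \<le> mass * (L * (s / t) / t ^ n * V k)"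
          unfolding n_def by (intro norm_avg_sub_avg_avg_le bounded_lipschitz_avg f s V[unfolded n_def] V0)
        also have "\<dots> = mass * L * V k / t ^ n * (s / t)" by (simp add: mult_ac)
        also have "\<dots> \<le> mass * L * V k / t ^ n * (2 / 2 ^ k)"
          using s t V0 L_nonneg mass_nonneg by (intro mult_left_mono) (auto simp: field_simps)
        also have "\<dots> = K * \<theta> ^ k"
          by (simp add: K_def Vk[of k] \<theta>_def power_divide)
        finally show "norm (avg (t / 2 ^ k) (avg t f) y - avg s (avg (t / 2 ^ k) (avg t f)) y) \<le> K * \<theta> ^ k" .
      qed
      also have "norm (avg t (avg t f) y) \<le> 3 * L / t ^ n * V 0"
        unfolding n_def using V[of 0] by (intro norm_avg_le_ball bounded_lipschitz_avg f t V0) simp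
      also have "3 * L / t ^ n * V 0 + 5 * K / (1 - \<theta>) = (3 * L + 10 * mass * L / (1 - \<theta>)) * (V 0 / t ^ n)"
        by (simp add: K_def algebra_simps)
      also have "V 0 / t ^ n = P powr (1 - r) * H * (4 powr (N * (1 - r)) * 6 ^ n) * (D powr (N * (1 - r)) * D ^ n)"
        using t D by (simp add: V_def powr_mult power_mult_distrib)
      also have "D powr (N * (1 - r)) * D ^ n = D powr N"
      proof -
        have "D powr (N * (1 - r)) * D ^ n = D powr (N * (1 - r) + n)"
          using D by (simp add: powr_add powr_realpow)
        then show ?thesis by (simp only: N(3))
      qed
      finally show ?thesis by (simp add: C_def D_def mult_ac)
    qed
    then have "P \<le> C * P powr (1 - r) * H"
      unfolding P_def by (intro peetre_max_le)
    moreover have "P = P powr r * P powr (1 - r)"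
      using P by (simp add: powr_add[symmetric])
    ultimately have *: "P powr r * P powr (1 - r) \<le> (C * H) * P powr (1 - r)"
      by (simp add: mult_ac)
    have "P powr r \<le> C * H"
    proof (cases "P = 0")
      case False
      then have "0 < P powr (1 - r)" using P by simp
      then show ?thesis using * by (rule mult_right_le_imp_le[rotated])
    qed (use C H in simp)
    then show ?thesis by (simp add: P_def H_def M_def)
  qed
  then show ?thesis using C by (auto simp: N_def n_def)
qed

end

subsection \<open>Exterior balls of Lipschitz domains\<close>

text \<open>After subtracting T 0, a distance-preserving self-map of a Euclidean space is an
  orthogonal transformation. Surjectivity lets points built in local coordinates be pulled
  back.\<close>

lemma isometry_surj:
  fixes T :: "'a::euclidean_space \<Rightarrow> 'a"
  assumes "\<forall>a b. dist (T a) (T b) = dist a b"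
  shows "surj T"
proof -
  have "orthogonal_transformation (\<lambda>x. T x - T 0)"
    unfolding orthogonal_transformation_isometry using assms by (simp add: dist_norm)
  then have "surj (\<lambda>x. T x - T 0)" by (rule orthogonal_transformation_surj)
  then have range: "range (\<lambda>x. T x - T 0) = UNIV" .
  have "y \<in> range T" for y
  proof -
    have "y - T 0 \<in> range (\<lambda>x. T x - T 0)" by (simp only: range UNIV_I)
    then obtain x where "y - T 0 = T x - T 0" by blast
    then have "y = T x" by simp
    then show ?thesis by blast
  qed
  then show ?thesis by blast
qed

text \<open>From q, move up by (1 + L) d in the local coordinates. Within the ball of radius d the
  base point moves by less than d, so the graph rises by at most L d, while the height stays above h
  + L d: the whole ball lies above the graph.\<close>

lemma lipschitz_domain_exterior_ball_near_boundary:
  fixes \<Omega> :: "'a::euclidean_space set"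
  assumes "bounded \<Omega>" "lipschitz_domain \<Omega>"
  shows "\<exists>K\<ge>1. \<exists>\<epsilon>>0. \<forall>q\<in>frontier \<Omega>. \<forall>d. 0 < d \<longrightarrow> d < \<epsilon> \<longrightarrow>
    (\<exists>z. dist q z \<le> K * d \<and> ball z d \<inter> \<Omega> = {})"
proof -
  obtain L where L: "\<forall>x \<in> frontier \<Omega>. \<exists>U (T :: 'a \<Rightarrow> 'a). \<exists>e \<in> Basis. \<exists>\<delta> > 0. \<exists>h :: 'a \<Rightarrow> real.
        open U \<and> x \<in> U \<and> (\<forall>a b. dist (T a) (T b) = dist a b) \<and>
        L-lipschitz_on (base_disc e \<delta>) h \<and>
        T ` (U \<inter> frontier \<Omega>) = {y + h y *\<^sub>R e | y. y \<in> base_disc e \<delta>} \<and>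
        T ` (U \<inter> \<Omega>) = T ` U \<inter> {y + s *\<^sub>R e | y s. y \<in> base_disc e \<delta> \<and> s < h y}"
    using assms(2) unfolding lipschitz_domain_def by blast
  define chart where "chart U T e \<delta> h \<longleftrightarrow> open U \<and> e \<in> Basis \<and> (\<forall>a b. dist (T a) (T b) = dist a b) \<and>
        L-lipschitz_on (base_disc e \<delta>) h \<and>
        T ` (U \<inter> frontier \<Omega>) = {y + h y *\<^sub>R e | y. y \<in> base_disc e \<delta>} \<and>
        T ` (U \<inter> \<Omega>) = T ` U \<inter> {y + s *\<^sub>R e | y s. y \<in> base_disc e \<delta> \<and> s < h y}"
    for U and T :: "'a \<Rightarrow> 'a" and e \<delta> h
  define \<U> where "\<U> = {U. \<exists>T e \<delta> h. chart U T e \<delta> h}"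
  have cover: "frontier \<Omega> \<subseteq> \<Union>\<U>"
  proof
    fix x assume "x \<in> frontier \<Omega>"
    from bspec[OF L this] have "\<exists>U. x \<in> U \<and> (\<exists>T e \<delta> h. chart U T e \<delta> h)"
      unfolding chart_def by (elim exE bexE conjE) (intro exI conjI; assumption)
    then show "x \<in> \<Union>\<U>" unfolding \<U>_def by blast
  qed
  have op: "\<And>U. U \<in> \<U> \<Longrightarrow> open U" unfolding \<U>_def chart_def by blast
  \<comment> \<open>A Lebesgue number of the cover: compactness of the boundary makes the size of
    the charts uniform.\<close>
  have "\<exists>\<epsilon>>0. \<forall>x \<in> frontier \<Omega>. \<exists>U \<in> \<U>. ball x \<epsilon> \<subseteq> U"
    by (rule Heine_Borel_lemma[OF compact_frontier_bounded[OF assms(1)] cover op]) blast+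
  then obtain \<epsilon>' where \<epsilon>': "0 < \<epsilon>'" "\<And>x. x \<in> frontier \<Omega> \<Longrightarrow> \<exists>U \<in> \<U>. ball x \<epsilon>' \<subseteq> U"
    by blast
  \<comment> \<open>The absolute value gives K \<ge> 1 before any chart is available to show that L
    is non-negative.\<close>
  define K where "K = 1 + \<bar>L\<bar>"
  have K1: "1 \<le> K" by (simp add: K_def)
  show ?thesis
  proof (rule exI[of _ K], intro conjI K1, rule exI[of _ "\<epsilon>' / (K + 1)"], intro conjI ballI allI impI)
    show "0 < \<epsilon>' / (K + 1)" using \<epsilon>' K1 by simp
    fix q d assume q: "q \<in> frontier \<Omega>" and d: "0 < d" "d < \<epsilon>' / (K + 1)"
    \<comment> \<open>Keeps the ball of radius d about z inside U, where alone the chart describes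
      the domain.\<close>
    have dK: "K * d + d < \<epsilon>'" using d(2) K1 by (simp add: field_simps)
    obtain U T e \<delta> h where chart: "chart U T e \<delta> h" and U: "ball q \<epsilon>' \<subseteq> U"
      using \<epsilon>'(2)[OF q] unfolding \<U>_def by blast
    then have iso: "\<forall>a b. dist (T a) (T b) = dist a b" and e: "e \<in> Basis"
      and lip: "L-lipschitz_on (base_disc e \<delta>) h"
      and bd: "T ` (U \<inter> frontier \<Omega>) = {y + h y *\<^sub>R e | y. y \<in> base_disc e \<delta>}"
      and dom: "T ` (U \<inter> \<Omega>) = T ` U \<inter> {y + s *\<^sub>R e | y s. y \<in> base_disc e \<delta> \<and> s < h y}"
      by (simp_all add: chart_def)
    have L0: "0 \<le> L" using lip lipschitz_on_nonneg by blast
    have "q \<in> U" using U \<epsilon>'(1) by auto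
    then have "T q \<in> {y + h y *\<^sub>R e | y. y \<in> base_disc e \<delta>}" using q bd by blast
    then obtain y0 where y0: "y0 \<in> base_disc e \<delta>" "T q = y0 + h y0 *\<^sub>R e" by blast
    obtain z where z: "T z = T q + (K * d) *\<^sub>R e" using isometry_surj[OF iso] by (metis surjD)
    have dqz: "dist q z = K * d"
    proof -
      have "dist q z = dist (T q) (T z)" using iso by simp
      also have "\<dots> = K * d" using e K1 d by (simp add: z dist_norm)
      finally show ?thesis .
    qed
    have "w \<notin> \<Omega>" if w: "w \<in> ball z d" for w
    proof
      assume "w \<in> \<Omega>"
      have "dist q w < K * d + d" using w dqz dist_triangle[of q w z] by simp
      then have "w \<in> U" using U dK by auto
      then have "T w \<in> {y + s *\<^sub>R e | y s. y \<in> base_disc e \<delta> \<and> s < h y}"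
        using \<open>w \<in> \<Omega>\<close> dom by blast
      then obtain y s where y: "T w = y + s *\<^sub>R e" "y \<in> base_disc e \<delta>" "s < h y" by blast
      have orth: "y \<bullet> e = 0" "y0 \<bullet> e = 0" using y(2) y0(1) by (auto simp: base_disc_def)
      define v where "v = T w - T z"
      have v: "norm v < d"
        using w iso by (simp add: v_def dist_norm[symmetric] dist_commute)
      have veq: "v = (y - y0) + (s - h y0 - K * d) *\<^sub>R e"
        by (simp add: v_def y(1) z y0(2) algebra_simps)
      have ve: "v \<bullet> e = s - h y0 - K * d"
        using e orth by (simp add: veq inner_add_left inner_diff_left)
      have nv: "(norm v)\<^sup>2 = (norm (y - y0))\<^sup>2 + (s - h y0 - K * d)\<^sup>2"
      proof -
        have "(norm v)\<^sup>2 = (norm (y - y0))\<^sup>2 + (norm ((s - h y0 - K * d) *\<^sub>R e))\<^sup>2"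
          unfolding veq by (rule norm_add_Pythagorean) (simp add: orthogonal_def inner_diff_left orth)
        then show ?thesis using e by simp
      qed
      have "(norm (y - y0))\<^sup>2 \<le> (norm v)\<^sup>2" using nv by simp
      then have 1: "norm (y - y0) < d" using v by (meson norm_ge_zero order_le_less_trans power2_le_imp_le)
      have "\<bar>v \<bullet> e\<bar> \<le> norm v" using e by (rule Basis_le_norm)
      then have 2: "h y0 + K * d - d < s" using v ve by linarith
      have "h y - h y0 \<le> L * norm (y - y0)"
        using lipschitz_onD[OF lip y(2) y0(1)] by (simp add: dist_norm)
      also have "\<dots> \<le> L * d" using 1 L0 by (intro mult_left_mono) auto
      also have "L * d = K * d - d" using L0 by (simp add: K_def algebra_simps)
      finally show False using 2 y(3) by simp
    qed
    then show "\<exists>z. dist q z \<le> K * d \<and> ball z d \<inter> \<Omega> = {}"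
      using dqz by (intro exI[of _ z]) auto
  qed
qed

text \<open>Near the boundary the local lemma is used at a nearest boundary point. Elsewhere d is
  bounded below by \<epsilon>/2, and a point far outside the bounded set is still at distance at
  most a multiple of d.\<close>

lemma lipschitz_domain_exterior_ball:
  fixes \<Omega> :: "'a::euclidean_space set"
  assumes bdd: "bounded \<Omega>" and lip: "lipschitz_domain \<Omega>"
  shows "\<exists>K\<ge>1. \<forall>x\<in>\<Omega>. 0 < infdist x (frontier \<Omega>) \<and>
    (\<exists>z. dist x z \<le> K * infdist x (frontier \<Omega>) \<and> cball z (infdist x (frontier \<Omega>)) \<inter> \<Omega> = {})"
proof -
  define Q where "Q K \<epsilon> \<longleftrightarrow> (\<forall>q\<in>frontier \<Omega>. \<forall>d. 0 < d \<longrightarrow> d < \<epsilon> \<longrightarrow>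
    (\<exists>z. dist q z \<le> K * d \<and> ball z d \<inter> \<Omega> = {}))" for K \<epsilon>
  have "\<exists>K\<ge>1. \<exists>\<epsilon>>0. Q K \<epsilon>"
    unfolding Q_def by (rule lipschitz_domain_exterior_ball_near_boundary[OF assms])
  then obtain K \<epsilon> where K: "1 \<le> K" and \<epsilon>: "0 < \<epsilon>" and "Q K \<epsilon>" by blast
  then have near: "\<exists>z. dist q z \<le> K * d \<and> ball z d \<inter> \<Omega> = {}"
    if "q \<in> frontier \<Omega>" "0 < d" "d < \<epsilon>" for q d
    using that unfolding Q_def by simp
  have op: "open \<Omega>" and "\<Omega> \<noteq> {}" using lip by (auto simp: lipschitz_domain_def)
  obtain R where R: "0 < R" "\<And>x. x \<in> \<Omega> \<Longrightarrow> norm x \<le> R" using bdd unfolding bounded_pos by blast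
  \<comment> \<open>Excludes the convention that the distance to the empty set is 0.\<close>
  have "frontier \<Omega> \<noteq> {}"
    using frontier_eq_empty[of \<Omega>] \<open>\<Omega> \<noteq> {}\<close> bdd not_bounded_UNIV by auto
  have pos: "0 < infdist x (frontier \<Omega>)" if x: "x \<in> \<Omega>" for x
  proof -
    have "x \<notin> frontier \<Omega>" using x op by (simp add: frontier_def interior_open)
    then show ?thesis
      using infdist_pos_not_in_closed[of "frontier \<Omega>" x] \<open>frontier \<Omega> \<noteq> {}\<close> by simp
  qed
  define K' where "K' = max (1 + 2 * K) (1 + 6 * R / \<epsilon>)"
  have "\<exists>z. dist x z \<le> K' * infdist x (frontier \<Omega>) \<and> cball z (infdist x (frontier \<Omega>)) \<inter> \<Omega> = {}"
    if x: "x \<in> \<Omega>" for x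
  proof -
    define d where "d = infdist x (frontier \<Omega>)"
    have d: "0 < d" using pos[OF x] by (simp add: d_def)
    have "\<exists>z. dist x z \<le> K' * d \<and> cball z d \<inter> \<Omega> = {}"
    proof (cases "2 * d < \<epsilon>")
      case True
      obtain q where q: "q \<in> frontier \<Omega>" "infdist x (frontier \<Omega>) = dist x q"
        by (rule infdist_attains_inf[OF _ \<open>frontier \<Omega> \<noteq> {}\<close>, of x]) auto
      \<comment> \<open>Radius 2 d, because the local lemma gives open balls and a closed one of
        radius d is wanted.\<close>
      obtain z where z: "dist q z \<le> K * (2 * d)" "ball z (2 * d) \<inter> \<Omega> = {}"
        using near[OF q(1) _ True] d by auto
      have "dist x z \<le> d + K * (2 * d)"
        using dist_triangle[of x z q] z(1) q(2) by (simp add: d_def)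
      also have "\<dots> = (1 + 2 * K) * d" by (simp add: algebra_simps)
      also have "\<dots> \<le> K' * d" using d by (intro mult_right_mono) (auto simp: K'_def)
      finally have "dist x z \<le> K' * d" .
      moreover have "cball z d \<subseteq> ball z (2 * d)" using d by auto
      ultimately show ?thesis using z(2) by blast
    next
      case False
      obtain b :: 'a where b: "b \<in> Basis" using nonempty_Basis by blast
      define z where "z = x + (3 * R + d) *\<^sub>R b"
      have "dist x z = 3 * R + d" using R(1) d b by (simp add: z_def dist_norm)
      also have "3 * R \<le> 6 * R / \<epsilon> * d"
      proof -
        have "3 * R * \<epsilon> \<le> 3 * R * (2 * d)" using False R(1) by (intro mult_left_mono) auto
        then show ?thesis using \<epsilon> by (simp add: field_simps)
      qed
      also have "6 * R / \<epsilon> * d + d = (1 + 6 * R / \<epsilon>) * d" by (simp add: algebra_simps)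
      also have "\<dots> \<le> K' * d" using d by (intro mult_right_mono) (auto simp: K'_def)
      finally have "dist x z \<le> K' * d" by simp
      moreover have "w \<notin> \<Omega>" if w: "w \<in> cball z d" for w
      proof
        assume "w \<in> \<Omega>"
        then have "dist x w \<le> 2 * R"
          using R(2)[OF x] R(2)[of w] norm_triangle_ineq4[of x w] by (simp add: dist_norm)
        moreover have "dist x z \<le> dist x w + d" using w dist_triangle[of x z w] by (simp add: dist_commute)
        ultimately show False using \<open>dist x z = 3 * R + d\<close> R(1) by simp
      qed
      ultimately show ?thesis by blast
    qed
    then show ?thesis by (simp add: d_def)
  qed
  moreover have "1 \<le> K'" using K by (simp add: K'_def)
  ultimately show ?thesis using pos by blast
qed

subsection \<open>Test functions and their averages\<close>

lemma norm_sum_scaleR_inner_le: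
  fixes G :: "'a::euclidean_space \<Rightarrow> 'b::real_normed_vector"
  shows "norm (\<Sum>j\<in>Basis. (v \<bullet> j) *\<^sub>R G j) \<le> (\<Sum>j\<in>Basis. norm (G j)) * norm v"
proof -
  have "norm (\<Sum>j\<in>Basis. (v \<bullet> j) *\<^sub>R G j) \<le> (\<Sum>j\<in>Basis. norm ((v \<bullet> j) *\<^sub>R G j))"
    by (rule norm_sum)
  also have "\<dots> \<le> (\<Sum>j\<in>Basis. norm (G j) * norm v)"
    by (intro sum_mono) (simp add: mult.commute[of _ "norm v"] mult_right_mono Basis_le_norm)
  finally show ?thesis by (simp add: sum_distrib_right)
qed

lemma bounded_linear_sum_scaleR_inner:
  fixes G :: "'a::euclidean_space \<Rightarrow> 'b::real_normed_vector"
  shows "bounded_linear (\<lambda>v. \<Sum>j\<in>Basis. (v \<bullet> j) *\<^sub>R G j)"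
  by (intro bounded_linear_sum bounded_linear_scaleR_const bounded_linear_inner_left)

lemma smooth_has_derivative:
  assumes "smooth f"
  shows "(f has_derivative (\<lambda>v. \<Sum>j\<in>Basis. (v \<bullet> j) *\<^sub>R partial_deriv j f x)) (at x)"
proof -
  have "f differentiable (at x)"
    using assms unfolding smooth_def by (metis iter_partial_deriv.simps(1) lists.Nil)
  then obtain D where D: "(f has_derivative D) (at x)" unfolding differentiable_def by blast
  then have lin: "linear D" by (rule has_derivative_linear)
  have Dj: "partial_deriv j f x = D j" for j
  proof -
    have "((\<lambda>t. x + t *\<^sub>R j) has_derivative (\<lambda>t. t *\<^sub>R j)) (at (0::real))"
      by (auto intro!: derivative_eq_intros)
    moreover have "(f has_derivative D) (at (x + 0 *\<^sub>R j))" using D by simp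
    ultimately have "((\<lambda>t. f (x + t *\<^sub>R j)) has_derivative (\<lambda>t. D (t *\<^sub>R j))) (at 0)"
      by (rule has_derivative_compose)
    then have "((\<lambda>t. f (x + t *\<^sub>R j)) has_vector_derivative D j) (at 0)"
      by (simp add: has_vector_derivative_def linear_scale[OF lin])
    then show ?thesis by (simp add: partial_deriv_def vector_derivative_at)
  qed
  have "D v = (\<Sum>j\<in>Basis. (v \<bullet> j) *\<^sub>R partial_deriv j f x)" for v
  proof -
    have "D v = D (\<Sum>j\<in>Basis. (v \<bullet> j) *\<^sub>R j)" by (simp add: euclidean_representation)
    also have "\<dots> = (\<Sum>j\<in>Basis. (v \<bullet> j) *\<^sub>R partial_deriv j f x)"
      by (simp add: Dj linear_sum[OF lin] linear_scale[OF lin])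
    finally show ?thesis .
  qed
  then have "D = (\<lambda>v. \<Sum>j\<in>Basis. (v \<bullet> j) *\<^sub>R partial_deriv j f x)" by blast
  then show ?thesis using D by simp
qed

lemma test_functions_outside:
  "f \<in> test_functions \<Omega> \<Longrightarrow> x \<notin> \<Omega> \<Longrightarrow> f x = 0"
  using closure_subset[of "support_on UNIV f"]
  by (force simp: test_functions_def supp_def support_on_def)

lemma test_functions_bounded:
  assumes f: "f \<in> test_functions \<Omega>"
  shows "bounded (range f)"
proof -
  have "compact (f ` supp f)"
    using f by (intro compact_continuous_image smooth_continuous_on) (auto simp: test_functions_def)
  then have "bounded (insert 0 (f ` supp f))" by (simp add: compact_imp_bounded)
  moreover have "range f \<subseteq> insert 0 (f ` supp f)"
    using closure_subset[of "support_on UNIV f"] by (force simp: supp_def support_on_def)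
  ultimately show ?thesis by (rule bounded_subset)
qed

text \<open>The partial derivatives are test functions again, hence bounded; the mean value
  inequality does the rest.\<close>

lemma test_functions_bounded_lipschitz:
  assumes f: "f \<in> test_functions \<Omega>"
  shows "bounded_lipschitz f"
proof -
  have "\<exists>B. \<forall>x. norm (partial_deriv j f x) \<le> B" if "j \<in> Basis" for j
    using test_functions_bounded[OF test_functions_partial_deriv[OF f that]]
    unfolding bounded_iff by blast
  then obtain B where B: "\<And>j x. j \<in> Basis \<Longrightarrow> norm (partial_deriv j f x) \<le> B j" by metis
  have "(\<Sum>j\<in>Basis. B j)-lipschitz_on UNIV f"
  proof (rule lipschitz_onI)
    fix x y :: 'a
    have "norm (f x - f y) \<le> (\<Sum>j\<in>Basis. B j) * norm (x - y)"
    proof (rule differentiable_bound)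
      fix z :: 'a
      show "(f has_derivative (\<lambda>v. \<Sum>j\<in>Basis. (v \<bullet> j) *\<^sub>R partial_deriv j f z)) (at z within UNIV)"
        using f by (simp add: test_functions_def smooth_has_derivative)
      show "onorm (\<lambda>v. \<Sum>j\<in>Basis. (v \<bullet> j) *\<^sub>R partial_deriv j f z) \<le> (\<Sum>j\<in>Basis. B j)"
        by (intro onorm_le order_trans[OF norm_sum_scaleR_inner_le] mult_right_mono sum_mono B) auto
    qed auto
    then show "dist (f x) (f y) \<le> (\<Sum>j\<in>Basis. B j) * dist x y" by (simp add: dist_norm)
  next
    show "0 \<le> (\<Sum>j\<in>Basis. B j)"
      using B by (intro sum_nonneg) (meson norm_ge_zero order_trans)
  qed
  then show ?thesis using test_functions_bounded[OF f] by (auto simp: bounded_lipschitz_def)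
qed

text \<open>The mean value inequality for u minus its linear part at x, whose derivative is
  Lipschitz and vanishes at x. Uniformity of A in x is what survives integration against the
  kernel.\<close>

lemma test_functions_taylor:
  fixes u :: "'a::euclidean_space \<Rightarrow> complex"
  assumes u: "u \<in> test_functions \<Omega>"
  shows "\<exists>A. \<forall>x v. norm (u (x + v) - u x - (\<Sum>j\<in>Basis. (v \<bullet> j) *\<^sub>R partial_deriv j u x)) \<le> A * (norm v)\<^sup>2"
proof -
  have "\<exists>K. K-lipschitz_on UNIV (partial_deriv j u)" if "j \<in> Basis" for j
    using test_functions_bounded_lipschitz[OF test_functions_partial_deriv[OF u that]]
    by (simp add: bounded_lipschitz_def)
  then obtain K where K: "\<And>j. j \<in> Basis \<Longrightarrow> (K j)-lipschitz_on UNIV (partial_deriv j u)" by metis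
  define A where "A = (\<Sum>j\<in>Basis. K j)"
  have A: "0 \<le> A" unfolding A_def using K lipschitz_on_nonneg by (intro sum_nonneg) blast
  have "norm (u (x + v) - u x - (\<Sum>j\<in>Basis. (v \<bullet> j) *\<^sub>R partial_deriv j u x)) \<le> A * (norm v)\<^sup>2" for x v
  proof -
    define g where "g y = u y - (\<Sum>j\<in>Basis. (y \<bullet> j) *\<^sub>R partial_deriv j u x)" for y
    have "norm (g (x + v) - g x) \<le> (A * norm v) * norm ((x + v) - x)"
    proof (rule differentiable_bound)
      show "convex (cball x (norm v))" by simp
      fix y assume y: "y \<in> cball x (norm v)"
      have "(g has_derivative (\<lambda>w. (\<Sum>j\<in>Basis. (w \<bullet> j) *\<^sub>R partial_deriv j u y) -
          (\<Sum>j\<in>Basis. (w \<bullet> j) *\<^sub>R partial_deriv j u x))) (at y)"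
        unfolding g_def using u
        by (intro has_derivative_diff smooth_has_derivative bounded_linear_imp_has_derivative
            bounded_linear_sum_scaleR_inner) (simp add: test_functions_def)
      then have "(g has_derivative (\<lambda>w. \<Sum>j\<in>Basis. (w \<bullet> j) *\<^sub>R (partial_deriv j u y - partial_deriv j u x))) (at y)"
        by (simp add: sum_subtractf scaleR_right_diff_distrib)
      then show "(g has_derivative (\<lambda>w. \<Sum>j\<in>Basis. (w \<bullet> j) *\<^sub>R (partial_deriv j u y - partial_deriv j u x)))
          (at y within cball x (norm v))"
        by (rule has_derivative_at_withinI)
      have "(\<Sum>j\<in>Basis. norm (partial_deriv j u y - partial_deriv j u x)) \<le> A * norm v"
        unfolding A_def sum_distrib_right
      proof (rule sum_mono)
        fix j :: 'a assume j: "j \<in> Basis"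
        have "norm (partial_deriv j u y - partial_deriv j u x) \<le> K j * dist y x"
          using lipschitz_onD[OF K[OF j], of y x] by (simp add: dist_norm)
        also have "\<dots> \<le> K j * norm v"
          using y lipschitz_on_nonneg[OF K[OF j]] by (intro mult_left_mono) (auto simp: dist_commute)
        finally show "norm (partial_deriv j u y - partial_deriv j u x) \<le> K j * norm v" .
      qed
      then show "onorm (\<lambda>w. \<Sum>j\<in>Basis. (w \<bullet> j) *\<^sub>R (partial_deriv j u y - partial_deriv j u x)) \<le> A * norm v"
        by (intro onorm_le order_trans[OF norm_sum_scaleR_inner_le] mult_right_mono) auto
    qed (auto simp: dist_norm)
    moreover have "g (x + v) - g x = u (x + v) - u x - (\<Sum>j\<in>Basis. (v \<bullet> j) *\<^sub>R partial_deriv j u x)"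
      by (simp add: g_def inner_add_left scaleR_left_distrib sum.distrib)
    ultimately show ?thesis by (simp add: power2_eq_square mult.assoc)
  qed
  then show ?thesis by blast
qed

text \<open>After division by the sum every term lies in [0,1], where raising to a power p \<le> 1
  does not decrease it.\<close>

lemma powr_sum_le:
  fixes a :: "'b \<Rightarrow> real"
  assumes "finite A" and a: "\<And>i. i \<in> A \<Longrightarrow> 0 \<le> a i" and p: "0 < p" "p \<le> 1"
  shows "(\<Sum>i\<in>A. a i) powr p \<le> (\<Sum>i\<in>A. a i powr p)"
proof -
  define S where "S = (\<Sum>i\<in>A. a i)"
  have S0: "0 \<le> S" unfolding S_def by (intro sum_nonneg a)
  show ?thesis
  proof (cases "S = 0")
    case True
    then show ?thesis by (simp add: S_def[symmetric] sum_nonneg)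
  next
    case False
    then have S: "0 < S" using S0 by simp
    have "S powr p * (a i / S) \<le> a i powr p" if i: "i \<in> A" for i
    proof -
      have le: "a i \<le> S" unfolding S_def by (rule member_le_sum[OF i]) (use a assms(1) in auto)
      have "(a i / S) powr 1 \<le> (a i / S) powr p"
        using S a[OF i] le p by (intro powr_mono') auto
      then have "a i / S \<le> (a i / S) powr p" using S a[OF i] by simp
      then have "S powr p * (a i / S) \<le> S powr p * (a i / S) powr p" by (intro mult_left_mono) auto
      also have "\<dots> = a i powr p" using S a[OF i] by (simp add: powr_mult[symmetric])
      finally show ?thesis .
    qed
    then have "(\<Sum>i\<in>A. S powr p * (a i / S)) \<le> (\<Sum>i\<in>A. a i powr p)" by (rule sum_mono)
    moreover have "(\<Sum>i\<in>A. S powr p * (a i / S)) = S powr p"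
      using S by (simp add: sum_distrib_left[symmetric] sum_divide_distrib[symmetric] S_def[symmetric])
    ultimately show ?thesis by (simp add: S_def)
  qed
qed

lemma ennreal_powr_inverse:
  assumes "0 < p"
  shows "ennreal_powr (ennreal_powr X (1 / p)) p = X"
  using assms by (cases X) (auto simp: ennreal_powr_def powr_powr)

lemma ennreal_powr_mono_real:
  assumes "0 < p" "0 \<le> a" "ennreal a \<le> X"
  shows "ennreal (a powr p) \<le> ennreal_powr X p"
  using assms by (cases X) (auto simp: ennreal_powr_def intro!: ennreal_leI powr_mono2)

section \<open>Pointwise bound of a test function by the Peetre maximal functions of its
  derivatives\<close>

context averaging_kernel
begin

text \<open>Integrating the uniform Taylor remainder against the kernel leaves a quadratic error, so
  differentiation passes under the integral without a limit theorem.\<close>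

lemma avg_has_derivative:
  assumes u: "u \<in> test_functions \<Omega>"
  shows "(avg s u has_derivative (\<lambda>v. \<Sum>j\<in>Basis. (v \<bullet> j) *\<^sub>R avg s (partial_deriv j u) x)) (at x)"
proof -
  obtain A where A: "\<And>x v. norm (u (x + v) - u x - (\<Sum>j\<in>Basis. (v \<bullet> j) *\<^sub>R partial_deriv j u x)) \<le> A * (norm v)\<^sup>2"
    using test_functions_taylor[OF u] by blast
  have bl: "bounded_lipschitz u" "\<And>j. j \<in> Basis \<Longrightarrow> bounded_lipschitz (partial_deriv j u)"
    using test_functions_bounded_lipschitz u test_functions_partial_deriv[OF u] by blast+
  have le: "norm (avg s u (x + v) - avg s u x - (\<Sum>j\<in>Basis. (v \<bullet> j) *\<^sub>R avg s (partial_deriv j u) x)) \<le>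
      mass * (A * (norm v)\<^sup>2)" for v
  proof -
    have "(\<Sum>j\<in>Basis. (v \<bullet> j) *\<^sub>R avg s (partial_deriv j u) x) =
        (LINT y|lborel. (\<Sum>j\<in>Basis. (v \<bullet> j) *\<^sub>R (\<psi> y * partial_deriv j u (x - s *\<^sub>R y))))"
      unfolding avg_def integral_scaleR_right[symmetric]
      by (intro Bochner_Integration.integral_sum[symmetric] integrable_scaleR_right integrable_avg bl)
    then have "avg s u (x + v) - avg s u x - (\<Sum>j\<in>Basis. (v \<bullet> j) *\<^sub>R avg s (partial_deriv j u) x) =
        (LINT y|lborel. \<psi> y * u (x + v - s *\<^sub>R y) - \<psi> y * u (x - s *\<^sub>R y) -
          (\<Sum>j\<in>Basis. (v \<bullet> j) *\<^sub>R (\<psi> y * partial_deriv j u (x - s *\<^sub>R y))))"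
      unfolding avg_def
      by (simp add: bl integrable_avg integrable_scaleR_right Bochner_Integration.integrable_sum
          Bochner_Integration.integral_diff Bochner_Integration.integrable_diff)
    also have "\<dots> = (LINT y|lborel. \<psi> y * (u (x - s *\<^sub>R y + v) - u (x - s *\<^sub>R y) -
          (\<Sum>j\<in>Basis. (v \<bullet> j) *\<^sub>R partial_deriv j u (x - s *\<^sub>R y))))"
      by (intro Bochner_Integration.integral_cong refl)
        (simp add: right_diff_distrib sum_distrib_left add_diff_eq diff_add_eq)
    also have "norm \<dots> \<le> mass * (A * (norm v)\<^sup>2)"
      by (intro norm_integral_kernel_le A)
    finally show ?thesis .
  qed
  show ?thesis
  proof (rule has_derivativeI_sandwich[where e = 1 and H = "\<lambda>y. mass * A * norm (y - x)"])
    show "bounded_linear (\<lambda>v. \<Sum>j\<in>Basis. (v \<bullet> j) *\<^sub>R avg s (partial_deriv j u) x)"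
      by (rule bounded_linear_sum_scaleR_inner)
    show "((\<lambda>y. mass * A * norm (y - x)) \<longlongrightarrow> 0) (at x)"
      by (auto intro!: tendsto_eq_intros)
    fix y assume "y \<noteq> x"
    then have "0 < norm (y - x)" by simp
    then show "norm (avg s u y - avg s u x - (\<Sum>j\<in>Basis. ((y - x) \<bullet> j) *\<^sub>R avg s (partial_deriv j u) x)) /
        norm (y - x) \<le> mass * A * norm (y - x)"
      using le[of "y - x"] by (simp add: divide_le_eq power2_eq_square mult.assoc)
  qed simp
qed

text \<open>Mean value inequality on the ball of radius \<rho> about x: there the averaged
  derivatives are controlled by Peetre maximal functions taken at x alone, at the cost of the
  largest weight.\<close>

lemma norm_avg_diff_le_peetre_max:
  assumes u: "u \<in> test_functions \<Omega>" and s: "0 < s" and N: "0 \<le> N" and \<rho>: "norm (x - x') \<le> \<rho>"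
  shows "norm (avg s u x - avg s u x') \<le>
    (1 + \<rho> / s) powr N * (\<Sum>j\<in>Basis. peetre_max N (partial_deriv j u) x) * norm (x - x')"
proof (rule differentiable_bound)
  have bl: "\<And>j. j \<in> Basis \<Longrightarrow> bounded_lipschitz (partial_deriv j u)"
    using test_functions_bounded_lipschitz test_functions_partial_deriv[OF u] by blast
  have \<rho>0: "0 \<le> \<rho>" using \<rho> norm_ge_zero order_trans by blast
  show "convex (cball x \<rho>)" by simp
  show "x \<in> cball x \<rho>" "x' \<in> cball x \<rho>" using \<rho> \<rho>0 by (auto simp: dist_norm)
  fix y assume y: "y \<in> cball x \<rho>"
  show "(avg s u has_derivative (\<lambda>v. \<Sum>j\<in>Basis. (v \<bullet> j) *\<^sub>R avg s (partial_deriv j u) y)) (at y within cball x \<rho>)"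
    by (rule has_derivative_at_withinI[OF avg_has_derivative[OF u]])
  have "(\<Sum>j\<in>Basis. norm (avg s (partial_deriv j u) y)) \<le>
      (1 + \<rho> / s) powr N * (\<Sum>j\<in>Basis. peetre_max N (partial_deriv j u) x)"
    unfolding sum_distrib_left
  proof (rule sum_mono)
    fix j :: 'a assume j: "j \<in> Basis"
    have "norm (avg s (partial_deriv j u) y) \<le> peetre_max N (partial_deriv j u) x * (1 + dist x y / s) powr N"
      by (rule norm_avg_le_peetre_max[OF bl[OF j] N s])
    also have "\<dots> \<le> peetre_max N (partial_deriv j u) x * (1 + \<rho> / s) powr N"
      using y s N peetre_max_nonneg[OF bl[OF j] N]
      by (intro mult_left_mono powr_mono2) (auto intro: divide_right_mono add_nonneg_nonneg)
    finally show "norm (avg s (partial_deriv j u) y) \<le>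
        (1 + \<rho> / s) powr N * peetre_max N (partial_deriv j u) x" by (simp add: mult.commute)
  qed
  then show "onorm (\<lambda>v. \<Sum>j\<in>Basis. (v \<bullet> j) *\<^sub>R avg s (partial_deriv j u) y) \<le>
      (1 + \<rho> / s) powr N * (\<Sum>j\<in>Basis. peetre_max N (partial_deriv j u) x)"
    by (intro onorm_le order_trans[OF norm_sum_scaleR_inner_le] mult_right_mono) auto
qed

text \<open>The first summand compares \<open>avg d u\<close> at x with its zero at z. The second is
  the telescoping bound with ratio 1/2, where 20 = 5 * 2 / (1 - 1/2) and the 2 comes from s \<le> 2
  d/2^k.\<close>

lemma norm_le_dist_times_peetre_max:
  assumes u: "u \<in> test_functions \<Omega>" and d: "0 < d" and N: "0 \<le> N" and K: "0 \<le> K"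
    and z: "dist x z \<le> K * d" "cball z d \<inter> \<Omega> = {}"
  shows "norm (u x) \<le>
    ((1 + K) powr N * K + 20 * mass * 3 powr N) * d * (\<Sum>j\<in>Basis. peetre_max N (partial_deriv j u) x)"
proof -
  define S where "S = (\<Sum>j\<in>Basis. peetre_max N (partial_deriv j u) x)"
  have bl: "bounded_lipschitz u" "\<And>j. j \<in> Basis \<Longrightarrow> bounded_lipschitz (partial_deriv j u)"
    using test_functions_bounded_lipschitz u test_functions_partial_deriv[OF u] by blast+
  have S: "0 \<le> S" unfolding S_def by (intro sum_nonneg peetre_max_nonneg bl N)
  have "norm (avg d u z) \<le> mass * 0"
    unfolding avg_def
  proof (rule norm_integral_kernel_le)
    \<comment> \<open>The average at z samples u only on the closed ball of radius d, which misses
      the domain.\<close>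
    fix y :: 'a assume "norm y \<le> 1"
    then have "z - d *\<^sub>R y \<in> cball z d" using d by (simp add: dist_norm mult_left_le)
    then have "z - d *\<^sub>R y \<notin> \<Omega>" using z(2) by blast
    then show "norm (u (z - d *\<^sub>R y)) \<le> 0" using test_functions_outside[OF u] by simp
  qed
  then have "norm (avg d u x) = norm (avg d u x - avg d u z)" by simp
  also have "\<dots> \<le> (1 + K * d / d) powr N * S * norm (x - z)"
    unfolding S_def by (rule norm_avg_diff_le_peetre_max[OF u d N]) (use z(1) in \<open>simp add: dist_norm\<close>)
  also have "\<dots> \<le> (1 + K) powr N * S * (K * d)"
    using z(1) d S by (intro mult_mono) (auto simp: dist_norm)
  finally have 1: "norm (avg d u x) \<le> (1 + K) powr N * K * d * S" by (simp add: mult_ac)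
  have "norm (u x) \<le> norm (avg d u x) + 5 * (mass * (2 * d * 3 powr N * S)) / (1 - 1 / 2)"
  proof (rule norm_le_avg_telescope[OF bl(1) d])
    show "0 \<le> mass * (2 * d * 3 powr N * S)" using mass_nonneg d S by simp
    fix k and s :: real assume s: "0 < s" "s \<le> d" "s \<le> 2 * d / 2 ^ k"
    have "norm (avg (d / 2 ^ k) u x - avg s (avg (d / 2 ^ k) u) x) \<le> mass * (3 powr N * S * (2 * d / 2 ^ k))"
    proof (rule norm_sub_avg_le[OF bounded_lipschitz_avg[OF bl(1)]])
      fix y :: 'a assume y: "norm y \<le> 1"
      have le: "norm (x - (x - s *\<^sub>R y)) \<le> s" using s y by (simp add: mult_left_le)
      have "norm (avg (d / 2 ^ k) u x - avg (d / 2 ^ k) u (x - s *\<^sub>R y)) \<le>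
          (1 + s / (d / 2 ^ k)) powr N * S * norm (x - (x - s *\<^sub>R y))"
        unfolding S_def by (rule norm_avg_diff_le_peetre_max[OF u _ N le]) (use d in simp)
      also have "\<dots> \<le> 3 powr N * S * (2 * d / 2 ^ k)"
      proof (intro mult_mono powr_mono2 N)
        \<comment> \<open>The shift is at most twice the current scale, so the weight is bounded
          independently of k.\<close>
        show "1 + s / (d / 2 ^ k) \<le> 3" using s(3) d by (simp add: field_simps)
        show "norm (x - (x - s *\<^sub>R y)) \<le> 2 * d / 2 ^ k" using le s(3) by linarith
      qed (use s d S in auto)
      finally show "norm (avg (d / 2 ^ k) u x - avg (d / 2 ^ k) u (x - s *\<^sub>R y)) \<le> 3 powr N * S * (2 * d / 2 ^ k)" .
    qed
    then show "norm (avg (d / 2 ^ k) u x - avg s (avg (d / 2 ^ k) u) x) \<le> mass * (2 * d * 3 powr N * S) * (1 / 2) ^ k"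
      by (simp add: power_divide mult_ac)
  qed simp_all
  then show ?thesis using 1 by (simp add: S_def[symmetric] algebra_simps)
qed

lemma vertical_max_le_maximal_function:
  assumes f: "bounded_lipschitz f"
  shows "ennreal (vertical_max f x) \<le> maximal_function \<psi> (regular_distribution f) x"
proof -
  have eq: "distr_convolution (regular_distribution f) (dilate \<psi> t) x = avg t f x" if "0 < t" for t
    unfolding distr_convolution_def regular_distribution_def dilate_def
    by (rule avg_eq_integral_dilated[OF f that, symmetric])
  define X where "X = maximal_function \<psi> (regular_distribution f) x"
  have X: "ennreal (norm (avg t f x)) \<le> X" if "0 < t" for t
    unfolding X_def maximal_function_def eq[OF that, symmetric] using that by (intro SUP_upper) auto
  have "ennreal (vertical_max f x) \<le> X"
  proof (cases X)
    case (real b)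
    have "vertical_max f x \<le> b"
      unfolding vertical_max_def
      by (rule cSUP_least) (use X real in \<open>auto simp: ennreal_le_iff\<close>)
    then show ?thesis using real by (simp add: ennreal_leI)
  qed simp
  then show ?thesis by (simp add: X_def)
qed

lemma nn_integral_vertical_max_powr_le:
  assumes f: "bounded_lipschitz f" and p: "0 < p"
  shows "(\<integral>\<^sup>+x. ennreal (vertical_max f x powr p) \<partial>lborel) \<le>
    ennreal_powr (hardy_norm \<psi> p (regular_distribution f)) p"
  unfolding hardy_norm_def ennreal_powr_inverse[OF p]
  by (intro nn_integral_mono ennreal_powr_mono_real vertical_max_le_maximal_function vertical_max_nonneg f p)

end

section \<open>Choice of exponents and assembly of the Hardy inequality\<close>

lemma hardy_kernel_averaging_kernel:
  assumes "hardy_kernel \<psi>"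
  shows "\<exists>L. averaging_kernel \<psi> L"
proof -
  have \<psi>: "\<psi> \<in> test_functions UNIV" "(LINT y|lborel. \<psi> y) = 1" "supp \<psi> \<subseteq> cball 0 1"
    using assms by (auto simp: hardy_kernel_def)
  obtain L where "L-lipschitz_on UNIV \<psi>"
    using test_functions_bounded_lipschitz[OF \<psi>(1)] by (auto simp: bounded_lipschitz_def)
  moreover have "\<psi> y = 0" if "1 < norm y" for y
  proof -
    have "y \<notin> supp \<psi>" using \<psi>(3) that by auto
    then show ?thesis
      using closure_subset[of "support_on UNIV \<psi>"] by (auto simp: supp_def support_on_def)
  qed
  ultimately show ?thesis using \<psi>(2) by (auto simp: averaging_kernel_def)
qed

theorem theorem24:
  fixes \<Omega> :: "'a::euclidean_space set" and \<psi> :: "'a \<Rightarrow> complex" and p :: real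
  assumes "bounded \<Omega>" and "lipschitz_domain \<Omega>"
    and "hardy_kernel \<psi>"
    and "real DIM('a) / (real DIM('a) + 1) < p" and "p \<le> 1"
  shows "\<exists>C::real. 0 \<le> C \<and> (\<forall>u \<in> test_functions \<Omega>.
    (\<integral>\<^sup>+x\<in>\<Omega>. ennreal ((norm (u x) / infdist x (frontier \<Omega>)) powr p) \<partial>lborel)
      \<le> ennreal C * (\<Sum>j\<in>Basis. ennreal_powr (hardy_norm \<psi> p (regular_distribution (partial_deriv j u))) p))"
proof -
  obtain L where "averaging_kernel \<psi> L" using hardy_kernel_averaging_kernel[OF assms(3)] by blast
  then interpret averaging_kernel \<psi> L .
  define n where "n = real DIM('a)"
  have n: "1 \<le> n" by (simp add: n_def DIM_positive Suc_leI)
  \<comment> \<open>The midpoint of n/(n+1) and p: above the first for convergence over the scales,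
    below the second so that the maximal theorem acts with exponent p/r > 1.\<close>
  define r where "r = (n / (n + 1) + p) / 2"
  define N where "N = n / r"
  have np: "n / (n + 1) < p" using assms(4) by (simp add: n_def)
  have half: "a < (a + p) / 2 \<and> (a + p) / 2 < p" if "a < p" for a using that by simp
  have r: "n / (n + 1) < r" "r < p" using half[OF np] by (simp_all only: r_def)
  have r0: "0 < r" by (rule le_less_trans[OF _ r(1)]) (use n in simp)
  have r1: "r < 1" and p0: "0 < p" using r r0 assms(5) by simp_all
  have N: "0 \<le> N" using n r0 by (simp add: N_def)
  have "n < r * (n + 1)" using r(1) n by (simp add: field_simps)
  then have "DIM('a) * (1 - r) / r < 1"
    using r0 by (simp add: n_def divide_less_eq algebra_simps)
  from peetre_max_powr_le[OF r0 r1 this] obtain C1 where C1: "0 \<le> C1"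
    and peetre: "\<And>f x. bounded_lipschitz f \<Longrightarrow>
      peetre_max N f x powr r \<le> C1 * enn2real (maximal_average (\<lambda>z. vertical_max f z powr r) x)"
    unfolding N_def n_def by blast
  define q where "q = p / r"
  have q: "1 < q" "r * q = p" using r r0 by (simp_all add: q_def)
  obtain C2 where C2: "0 \<le> C2" and HL: "\<And>g :: 'a \<Rightarrow> real. g \<in> borel_measurable borel \<Longrightarrow> (\<And>x. 0 \<le> g x) \<Longrightarrow>
      (\<integral>\<^sup>+x. ennreal (enn2real (maximal_average g x) powr q) \<partial>lborel) \<le> ennreal C2 * (\<integral>\<^sup>+x. ennreal (g x powr q) \<partial>lborel)"
    using maximal_average_strong_type[OF q(1)] by blast
  obtain K where K: "1 \<le> K" and ext: "\<And>x. x \<in> \<Omega> \<Longrightarrow> 0 < infdist x (frontier \<Omega>) \<and>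
      (\<exists>z. dist x z \<le> K * infdist x (frontier \<Omega>) \<and> cball z (infdist x (frontier \<Omega>)) \<inter> \<Omega> = {})"
    using lipschitz_domain_exterior_ball[OF assms(1,2)] by blast
  define C3 where "C3 = (1 + K) powr N * K + 20 * mass * 3 powr N"
  have C3: "0 \<le> C3" using K mass_nonneg by (simp add: C3_def)
  \<comment> \<open>C1 bounds the r-th power of the Peetre function, so its p-th power brings in
    C1^q with q = p/r.\<close>
  define A where "A = C3 powr p * C1 powr q"
  have A: "0 \<le> A" by (simp add: A_def)
  show ?thesis
  proof (intro exI[of _ "A * C2"] conjI ballI)
    show "0 \<le> A * C2" using A C2 by simp
    fix u assume u: "u \<in> test_functions \<Omega>"
    define D where "D j = partial_deriv j u" for j
    have bl: "bounded_lipschitz (D j)" if "j \<in> Basis" for j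
      unfolding D_def using that test_functions_bounded_lipschitz test_functions_partial_deriv[OF u] by blast
    define H where "H j x = enn2real (maximal_average (\<lambda>z. vertical_max (D j) z powr r) x)" for j x
    have meas: "(\<lambda>z. vertical_max (D j) z powr r) \<in> borel_measurable borel" if "j \<in> Basis" for j
      using borel_measurable_vertical_max[OF bl[OF that]] by measurable
    have H_meas: "H j \<in> borel_measurable borel" if "j \<in> Basis" for j
      unfolding H_def using borel_measurable_maximal_average[OF meas[OF that]] by measurable
    have H0: "0 \<le> H j x" for j x by (simp add: H_def)
    have pointwise: "(norm (u x) / infdist x (frontier \<Omega>)) powr p \<le> A * (\<Sum>j\<in>Basis. H j x powr q)"
      if x: "x \<in> \<Omega>" for x
    proof -
      define d where "d = infdist x (frontier \<Omega>)"
      have d: "0 < d" using ext[OF x] by (simp add: d_def)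
      obtain z where z: "dist x z \<le> K * d" "cball z d \<inter> \<Omega> = {}" using ext[OF x] by (auto simp: d_def)
      have "norm (u x) \<le> C3 * d * (\<Sum>j\<in>Basis. peetre_max N (D j) x)"
        unfolding C3_def D_def by (rule norm_le_dist_times_peetre_max[OF u d N _ z]) (use K in simp)
      then have "norm (u x) / d \<le> C3 * (\<Sum>j\<in>Basis. peetre_max N (D j) x)"
        using d by (simp add: field_simps)
      then have "(norm (u x) / d) powr p \<le> (C3 * (\<Sum>j\<in>Basis. peetre_max N (D j) x)) powr p"
        using d p0 by (intro powr_mono2) auto
      also have "\<dots> = C3 powr p * (\<Sum>j\<in>Basis. peetre_max N (D j) x) powr p"
        using C3 by (simp add: powr_mult)
      also have "\<dots> \<le> C3 powr p * (\<Sum>j\<in>Basis. peetre_max N (D j) x powr p)"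
        using p0 assms(5) by (intro mult_left_mono powr_sum_le peetre_max_nonneg bl N) auto
      also have "\<dots> \<le> C3 powr p * (\<Sum>j\<in>Basis. C1 powr q * H j x powr q)"
      proof (intro mult_left_mono sum_mono)
        fix j :: 'a assume j: "j \<in> Basis"
        have "peetre_max N (D j) x powr p = (peetre_max N (D j) x powr r) powr q"
          by (simp add: powr_powr q(2))
        also have "\<dots> \<le> (C1 * H j x) powr q"
          using q(1) peetre[OF bl[OF j]] by (intro powr_mono2) (auto simp: H_def)
        also have "\<dots> = C1 powr q * H j x powr q"
          using C1 H0 by (simp add: powr_mult)
        finally show "peetre_max N (D j) x powr p \<le> C1 powr q * H j x powr q" .
      qed simp
      also have "\<dots> = A * (\<Sum>j\<in>Basis. H j x powr q)"
        by (simp add: A_def sum_distrib_left[symmetric] mult.assoc)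
      finally show ?thesis by (simp add: d_def)
    qed
    have "(\<integral>\<^sup>+x\<in>\<Omega>. ennreal ((norm (u x) / infdist x (frontier \<Omega>)) powr p) \<partial>lborel) \<le>
        (\<integral>\<^sup>+x. ennreal A * (\<Sum>j\<in>Basis. ennreal (H j x powr q)) \<partial>lborel)"
    proof (intro nn_integral_mono)
      fix x
      show "ennreal ((norm (u x) / infdist x (frontier \<Omega>)) powr p) * indicator \<Omega> x \<le>
          ennreal A * (\<Sum>j\<in>Basis. ennreal (H j x powr q))"
      proof (cases "x \<in> \<Omega>")
        case True
        have "ennreal A * (\<Sum>j\<in>Basis. ennreal (H j x powr q)) = ennreal (A * (\<Sum>j\<in>Basis. H j x powr q))"
          using A by (simp add: sum_ennreal ennreal_mult sum_nonneg)
        then show ?thesis using True pointwise[OF True] by (simp add: ennreal_leI)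
      qed simp
    qed
    also have "\<dots> = ennreal A * (\<integral>\<^sup>+x. (\<Sum>j\<in>Basis. ennreal (H j x powr q)) \<partial>lborel)"
      using H_meas by (intro nn_integral_cmult) measurable
    also have "\<dots> = ennreal A * (\<Sum>j\<in>Basis. \<integral>\<^sup>+x. ennreal (H j x powr q) \<partial>lborel)"
      using H_meas by (subst nn_integral_sum) auto
    also have "\<dots> \<le> ennreal A * (\<Sum>j\<in>Basis. ennreal C2 * ennreal_powr (hardy_norm \<psi> p (regular_distribution (D j))) p)"
    proof (intro mult_left_mono sum_mono)
      fix j :: 'a assume j: "j \<in> Basis"
      \<comment> \<open>The maximal theorem is applied to the r-th power of the vertical maximal
        function; raising it to q restores the exponent p.\<close>
      have "(\<integral>\<^sup>+x. ennreal (H j x powr q) \<partial>lborel) \<le>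
          ennreal C2 * (\<integral>\<^sup>+x. ennreal ((vertical_max (D j) x powr r) powr q) \<partial>lborel)"
        unfolding H_def by (rule HL[OF meas[OF j]]) simp
      also have "\<dots> = ennreal C2 * (\<integral>\<^sup>+x. ennreal (vertical_max (D j) x powr p) \<partial>lborel)"
        by (simp add: powr_powr q(2))
      also have "\<dots> \<le> ennreal C2 * ennreal_powr (hardy_norm \<psi> p (regular_distribution (D j))) p"
        by (intro mult_left_mono nn_integral_vertical_max_powr_le bl j p0) simp
      finally show "(\<integral>\<^sup>+x. ennreal (H j x powr q) \<partial>lborel) \<le> \<dots>" .
    qed simp
    also have "\<dots> = ennreal (A * C2) * (\<Sum>j\<in>Basis. ennreal_powr (hardy_norm \<psi> p (regular_distribution (D j))) p)"
      using A C2 by (simp add: ennreal_mult sum_distrib_left[symmetric] mult.assoc)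
    finally show "(\<integral>\<^sup>+x\<in>\<Omega>. ennreal ((norm (u x) / infdist x (frontier \<Omega>)) powr p) \<partial>lborel)
      \<le> ennreal (A * C2) * (\<Sum>j\<in>Basis. ennreal_powr (hardy_norm \<psi> p (regular_distribution (partial_deriv j u))) p)"
      by (simp add: D_def)
  qed
qed

end
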